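(* For each $n$, let $t^{(n)}$ be a cycle type of size $n$ such that $t_1^{(n)}=O(\sqrt n)$, and let $\tau_n$ be a uniformly random $t^{(n)}$-cyclic permutation. 1. Suppose that $t_1^{(n)}+2t_2^{(n)}=n$ for all $n$. Then, in distribution, $$\frac{\mathrm{rec}^\downarrow(\tau_n)-\log n}{\sqrt{\log n}}\underset{n\to\infty}{\longrightarrow}\mathcal{N}(0,2).$$ 2. Suppose that $t_1^{(n)}+3t_3^{(n)}=n$ for all $n$. Then, in distribution, $$\frac{\mathrm{rec}^\downarrow(\tau_n)-\log n}{\sqrt{\log n}}\underset{n\to\infty}{\longrightarrow}\mathcal{N}(0,1).$$
   Context: A cycle type of size $n$ is a sequence $t=(t_1,\dots,t_n)$ of nonnegative integers with $\sum_{p=1}^n p\,t_p=n$ (with $t_p=0$ for $p>n$); a permutation of $[n]=\{1,\dots,n\}$ is $t$-cyclic if it has exactly $t_p$ cycles of length $p$ for every $p$ (fixed points are $1$-cycles). $\mathrm{rec}^\downarrow(\tau)$ is the number of low records (left-to-right minima) of $\tau$, i.e. of $i\in[n]$ such that $\tau(j)>\tau(i)$ for all $j<i$. $\mathcal{N}(0,\sigma^2)$ is the centered Gaussian law with variance $\sigma^2$. *)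

theory Defs
  imports
    "HOL-Probability.Probability"
    "HOL-Combinatorics.Orbits"
    "HOL-Combinatorics.Permutations"
    "HOL-Library.Landau_Symbols"
begin

text \<open>A cycle type of size \<open>n\<close> is a sequence indexed by \<open>p \<ge> 1\<close>; the value at \<open>p = 0\<close> plays no role.\<close>

definition cycle_type :: "nat \<Rightarrow> (nat \<Rightarrow> nat) \<Rightarrow> bool" where
  "cycle_type n t \<longleftrightarrow> (\<Sum>p=1..n. p * t p) = n \<and> (\<forall>p>n. t p = 0)"

text \<open>The cycles of \<open>\<tau>\<close> are identified with its orbits, so fixed points count as cycles of length 1.\<close>

definition num_cycles :: "nat \<Rightarrow> (nat \<Rightarrow> nat) \<Rightarrow> nat \<Rightarrow> nat" where
  "num_cycles n \<tau> p = card {C \<in> orbit \<tau> ` {1..n}. card C = p}"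

definition cyclic_perms :: "nat \<Rightarrow> (nat \<Rightarrow> nat) \<Rightarrow> (nat \<Rightarrow> nat) set" where
  "cyclic_perms n t = {\<tau>. \<tau> permutes {1..n} \<and> (\<forall>p\<ge>1. num_cycles n \<tau> p = t p)}"

text \<open>This is the uniform law because \<open>cyclic_perms n t\<close> is finite, and nonempty whenever
  \<open>cycle_type n t\<close> holds (on the empty set, \<^const>\<open>pmf_of_set\<close> is unspecified).\<close>

definition uniform_cyclic_perm :: "nat \<Rightarrow> (nat \<Rightarrow> nat) \<Rightarrow> (nat \<Rightarrow> nat) pmf" where
  "uniform_cyclic_perm n t = pmf_of_set (cyclic_perms n t)"

definition low_rec :: "nat \<Rightarrow> (nat \<Rightarrow> nat) \<Rightarrow> nat" where
  "low_rec n \<tau> = card {i \<in> {1..n}. \<forall>j\<in>{1..n}. j < i \<longrightarrow> \<tau> j > \<tau> i}"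

definition normalized_low_rec :: "nat \<Rightarrow> (nat \<Rightarrow> nat) \<Rightarrow> real" where
  "normalized_low_rec n \<tau> = (real (low_rec n \<tau>) - ln (real n)) / sqrt (ln (real n))"

text \<open>\<^const>\<open>normal_density\<close> is parametrised by the standard deviation, \<open>centered_normal\<close> by the variance.\<close>

definition centered_normal :: "real \<Rightarrow> real measure" where
  "centered_normal v = density lborel (\<lambda>x. ennreal (normal_density 0 (sqrt v) x))"

end

theory Submission
  imports
    Defs
    "HOL-Real_Asymp.Real_Asymp"
begin

text \<open>
  Let \<open>\<tau>\<close> be the random permutation and fix \<open>k\<close> slightly below \<open>sqrt n\<close>. Since \<open>\<tau>\<close> has \<open>O(sqrt n)\<close>
  fixed points and its law is invariant under conjugation, with high probability \<open>\<tau> i > k\<close> for all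
  \<open>i \<le> k\<close> (\<open>\<tau>\<close> is then called escaping). In that case a low record at position \<open>i\<close> cannot have both
  \<open>i \<le> k\<close> and \<open>\<tau> i \<le> k\<close>, so there are three disjoint kinds of low records. Those with \<open>i \<le> k\<close> are the
  records of the word \<open>\<tau> 1, \<dots>, \<tau> k\<close>. Reflecting the graph of \<open>\<tau>\<close> in the diagonal preserves low
  records, so those with \<open>\<tau> i \<le> k\<close> are counted by the records of the word \<open>inv \<tau> 1, \<dots>, inv \<tau> k\<close>.
  The remaining ones are few: as soon as both of these head words contain a letter \<open>\<le> A\<close>, with \<open>A\<close> slightly
  above \<open>sqrt n\<close>, they lie in the square \<open>[1, A] \<times> [1, A]\<close>, and this square contains on average only
  \<open>o (sqrt (ln n))\<close> points of the graph.

  Conjugating an escaping \<open>\<tau>\<close> by \<open>\<tau> \<circ> \<sigma> \<circ> inv \<tau>\<close>, where \<open>\<sigma>\<close> permutes \<open>{1..k}\<close>, shuffles the word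
  \<open>\<tau> 1, \<dots>, \<tau> k\<close> by \<open>\<sigma>\<close>, and this is a bijection of the set of escaping permutations. Hence the
  record count of this word is distributed as that of a uniform permutation of \<open>k\<close> letters, a sum of
  independent Bernoulli variables of parameters \<open>1/j\<close>, \<open>j \<le> k\<close>. It is asymptotically
  normal with mean and variance about \<open>ln k\<close>, that is, about \<open>ln n / 2\<close>.

  The two cases of the theorem differ only in the relation between the two words. For an involution they
  coincide, so that \<open>low_rec n \<tau>\<close> is close to twice one such count, with variance
  \<open>4 (ln n / 2) = 2 ln n\<close>. If all cycles have length 1 or 3, the two words of an escaping permutation use disjoint
  letters; shuffling the first leaves the second unchanged, so that \<open>low_rec n \<tau>\<close> is close to a sum of two
  independent counts, with variance \<open>2 (ln n / 2) = ln n\<close>.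

  Quantitatively, \<open>norm_sum_iexp_low_rec_le\<close> compares characteristic functions,
  \<open>sum_iexp_low_rec_involutions\<close> and \<open>sum_iexp_low_rec_order_three\<close> evaluate the main terms,
  \<open>record_pgf_tendsto\<close> gives their limits, and Levy's continuity theorem concludes.
\<close>

section \<open>Permutations of prime order and cycle types\<close>

text \<open>The powers of \<open>f\<close> run through the orbit of \<open>x\<close> periodically, and the period is the orbit's size.\<close>

lemma funpow_fix_iff_card_orbit_dvd:
  assumes "permutation f"
  shows "(f ^^ m) x = x \<longleftrightarrow> card (orbit f x) dvd m"
proof -
  define d where "d = funpow_dist1 f x x"
  have self: "x \<in> orbit f x"
    by (rule permutation_self_in_orbit[OF assms])
  have card: "card (orbit f x) = d"
    unfolding d_def orbit_conv_funpow_dist1[OF self]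
    by (subst card_image[OF inj_on_funpow_dist1[OF self]]) simp
  have fix_d: "(f ^^ d) x = x"
    unfolding d_def by (rule funpow_dist1_prop[OF self])
  have "(f ^^ m) x = x \<longleftrightarrow> m mod d = 0"
  proof
    assume "(f ^^ m) x = x"
    then have "(f ^^ (m mod d)) x = x"
      using funpow_mod_eq[OF fix_d] by simp
    moreover have "m mod d < d"
      by (simp add: d_def)
    ultimately show "m mod d = 0"
      using funpow_dist1_least[of "m mod d" f x x] by (auto simp: d_def)
  next
    assume "m mod d = 0"
    then show "(f ^^ m) x = x"
      using funpow_mod_eq[OF fix_d, of m] by simp
  qed
  then show ?thesis
    by (simp add: card mod_eq_0_iff_dvd)
qed

lemma sum_card_orbits:
  assumes "f permutes A" "finite A"
  shows "(\<Sum>C\<in>orbit f ` A. card C) = card A"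
proof -
  have perm: "permutation f"
    using assms permutation_permutes by blast
  have "card (\<Union> (orbit f ` A)) = (\<Sum>C\<in>orbit f ` A. card C)"
  proof (rule card_Union_disjoint)
    show "pairwise disjnt (orbit f ` A)"
    proof (rule pairwiseI)
      fix C D assume CD: "C \<in> orbit f ` A" "D \<in> orbit f ` A" "C \<noteq> D"
      then have "cyclic_on f C" "cyclic_on f D"
        using cyclic_on_orbit[OF assms] by auto
      then have "x \<in> C \<Longrightarrow> x \<in> D \<Longrightarrow> C = D" for x
        using orbit_cyclic_eq3 by metis
      with CD(3) show "disjnt C D"
        by (auto simp: disjnt_def)
    qed
    show "\<And>C. C \<in> orbit f ` A \<Longrightarrow> finite C"
      by (auto intro!: finite_orbit permutation_self_in_orbit[OF perm])
  qed
  moreover have "\<Union> (orbit f ` A) = A"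
    using permutes_orbit_subset[OF assms(1)] permutation_self_in_orbit[OF perm] by auto
  ultimately show ?thesis
    by simp
qed

lemma num_cycles_1:
  assumes "f permutes {1..n}"
  shows "num_cycles n f 1 = card {i \<in> {1..n}. f i = i}"
proof -
  have perm: "permutation f"
    using assms permutation_permutes by blast
  have "{C \<in> orbit f ` {1..n}. card C = 1} = (\<lambda>i. {i}) ` {i \<in> {1..n}. f i = i}"
  proof (intro equalityI subsetI)
    fix C assume "C \<in> {C \<in> orbit f ` {1..n}. card C = 1}"
    then obtain x where x: "x \<in> {1..n}" "C = orbit f x" "card C = 1" by auto
    then obtain y where "C = {y}" using card_1_singletonE by blast
    moreover have "x \<in> C" using x permutation_self_in_orbit[OF perm] by simp
    ultimately have "orbit f x = {x}" using x by auto
    then show "C \<in> (\<lambda>i. {i}) ` {i \<in> {1..n}. f i = i}"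
      using x orbit_eq_singleton_iff[of f x] by auto
  next
    fix C assume "C \<in> (\<lambda>i. {i}) ` {i \<in> {1..n}. f i = i}"
    then obtain x where x: "x \<in> {1..n}" "f x = x" "C = {x}" by auto
    then have "C = orbit f x" using orbit_eq_singleton_iff[of f x] by simp
    moreover have "card C = 1" using x by simp
    ultimately show "C \<in> {C \<in> orbit f ` {1..n}. card C = 1}"
      using x by blast
  qed
  then show ?thesis
    unfolding num_cycles_def by (simp add: card_image)
qed

text \<open>For prime \<open>p\<close> this is the set of permutations with \<open>a\<close> fixed points all of whose other cycles have
  length \<open>p\<close>; in this form, closure under conjugation and inversion is immediate.\<close>

definition prime_order_perms :: "nat \<Rightarrow> nat \<Rightarrow> nat \<Rightarrow> (nat \<Rightarrow> nat) set" where
  "prime_order_perms n p a =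
    {\<tau>. \<tau> permutes {1..n} \<and> \<tau> ^^ p = id \<and> card {i \<in> {1..n}. \<tau> i = i} = a}"

lemma cycle_type_two_lengths:
  assumes ct: "cycle_type n t" and p: "1 < p" and tp: "t 1 + p * t p = n"
    and q: "1 \<le> q" "q \<noteq> 1" "q \<noteq> p"
  shows "t q = 0"
proof (cases "q \<le> n")
  case True
  show ?thesis
  proof (rule ccontr)
    assume nz: "t q \<noteq> 0"
    show False
    proof (cases "p \<le> n")
      case True
      have "(\<Sum>i\<in>{1, p, q}. i * t i) \<le> (\<Sum>i=1..n. i * t i)"
        using \<open>q \<le> n\<close> True p q by (intro sum_mono2) auto
      then have "t 1 + p * t p + q * t q \<le> n"
        using ct p q by (simp add: cycle_type_def)
      then show False using tp nz q by simp
    next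
      case False
      then have "t p = 0" using ct by (simp add: cycle_type_def)
      have "(\<Sum>i\<in>{1, q}. i * t i) \<le> (\<Sum>i=1..n. i * t i)"
        using \<open>q \<le> n\<close> p q by (intro sum_mono2) auto
      then have "t 1 + q * t q \<le> n"
        using ct p q by (simp add: cycle_type_def)
      then show False using tp nz q \<open>t p = 0\<close> by simp
    qed
  qed
next
  case False
  then show ?thesis using ct by (simp add: cycle_type_def)
qed

text \<open>All orbit sizes divide \<open>p\<close> exactly when \<open>\<tau> ^^ p = id\<close>. Once only the sizes 1 and \<open>p\<close> occur, the number
  of fixed points determines the number of orbits of size \<open>p\<close>, because the sizes add up to \<open>n\<close>.\<close>

lemma cyclic_perms_eq_prime_order_perms:
  assumes ct: "cycle_type n t" and p: "prime p" and tp: "t 1 + p * t p = n"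
  shows "cyclic_perms n t = prime_order_perms n p (t 1)"
proof (intro equalityI subsetI)
  fix f assume "f \<in> cyclic_perms n t"
  then have f: "f permutes {1..n}" and nc: "\<And>q. q \<ge> 1 \<Longrightarrow> num_cycles n f q = t q"
    by (auto simp: cyclic_perms_def)
  have perm: "permutation f"
    using f permutation_permutes by blast
  have fin: "finite (orbit f x)" "orbit f x \<noteq> {}" for x
    using finite_orbit[OF permutation_self_in_orbit[OF perm]] orbit_nonempty[of f x] by auto
  have "(f ^^ p) x = x" for x
  proof (cases "x \<in> {1..n}")
    case True
    define q where "q = card (orbit f x)"
    have "q \<ge> 1"
      using fin[of x] by (simp add: q_def Suc_le_eq card_gt_0_iff)
    have "orbit f x \<in> {C \<in> orbit f ` {1..n}. card C = q}"
      using True by (simp add: q_def)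
    then have "num_cycles n f q > 0"
      unfolding num_cycles_def by (subst card_gt_0_iff) auto
    then have "q = 1 \<or> q = p"
      using cycle_type_two_lengths[OF ct _ tp \<open>q \<ge> 1\<close>] nc[OF \<open>q \<ge> 1\<close>] prime_gt_1_nat[OF p]
      by fastforce
    then show ?thesis
      by (auto simp: funpow_fix_iff_card_orbit_dvd[OF perm] q_def)
  next
    case False
    then have "f x = x" using f by (simp add: permutes_def)
    then show ?thesis by (induction p) auto
  qed
  then show "f \<in> prime_order_perms n p (t 1)"
    using f nc[of 1] num_cycles_1[OF f] by (auto simp: prime_order_perms_def fun_eq_iff)
next
  fix f assume "f \<in> prime_order_perms n p (t 1)"
  then have f: "f permutes {1..n}" and fp: "f ^^ p = id"
    and fix1: "num_cycles n f 1 = t 1"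
    using num_cycles_1 by (auto simp: prime_order_perms_def)
  have p1: "p > 1" by (rule prime_gt_1_nat[OF p])
  have perm: "permutation f"
    using f permutation_permutes by blast
  let ?O = "\<lambda>q. {C \<in> orbit f ` {1..n}. card C = q}"
  have cards: "card C = 1 \<or> card C = p" if "C \<in> orbit f ` {1..n}" for C
    using that p funpow_fix_iff_card_orbit_dvd[OF perm, of p] fp
    by (auto simp: prime_nat_iff)
  have "n = (\<Sum>C\<in>orbit f ` {1..n}. card C)"
    using sum_card_orbits[OF f] by simp
  also have "orbit f ` {1..n} = ?O 1 \<union> ?O p"
    using cards by auto
  also have "(\<Sum>C\<in>?O 1 \<union> ?O p. card C) = (\<Sum>C\<in>?O 1. card C) + (\<Sum>C\<in>?O p. card C)"
    using p1 by (intro sum.union_disjoint) auto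
  also have "\<dots> = t 1 + p * num_cycles n f p"
    using fix1 by (simp add: num_cycles_def)
  finally have "p * num_cycles n f p = p * t p"
    using tp by linarith
  then have "num_cycles n f p = t p"
    using p1 by simp
  moreover have "num_cycles n f q = 0" if "q \<noteq> 1" "q \<noteq> p" for q
  proof -
    have "?O q = {}" using cards that by auto
    then show ?thesis unfolding num_cycles_def by simp
  qed
  ultimately have "num_cycles n f q = t q" if "q \<ge> 1" for q
    using fix1 cycle_type_two_lengths[OF ct p1 tp that] by metis
  then show "f \<in> cyclic_perms n t"
    using f by (simp add: cyclic_perms_def)
qed

text \<open>The witness fixes \<open>{1..a}\<close> and rotates each of the \<open>b\<close> successive blocks of \<open>p\<close> consecutive
  integers that follow.\<close>

lemma prime_order_perms_nonempty:
  assumes p: "p > 1" and n: "n = a + p * b"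
  shows "prime_order_perms n p a \<noteq> {}"
proof -
  define f where "f i = (if a < i \<and> i \<le> n then if p dvd i - a then i - (p - 1) else i + 1 else i)" for i
  have run: "(f ^^ j) (a + p * q + 1) = a + p * q + 1 + j" if "q < b" "j < p" for q j
    using that(2)
  proof (induction j)
    case (Suc j)
    have "p * q + p \<le> p * b"
      using mult_le_mono2[of "q + 1" b p] that(1) by simp
    then have "a + p * q + 1 + j \<le> n"
      using Suc.prems n by simp
    moreover have "\<not> p dvd p * q + (1 + j)"
      using Suc.prems by (subst dvd_add_right_iff) (auto dest: dvd_imp_le)
    ultimately show ?case using Suc by (simp add: f_def add.assoc)
  qed simp
  have block: "(f ^^ p) (a + p * q + 1) = a + p * q + 1" if "q < b" for q
  proof -
    have "p * q + p \<le> p * b"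
      using mult_le_mono2[of "q + 1" b p] that by simp
    then have le: "a + p * q + p \<le> n" using n by simp
    have "(f ^^ p) (a + p * q + 1) = f ((f ^^ (p - 1)) (a + p * q + 1))"
      using p by (metis Suc_diff_1 funpow.simps(2) o_apply less_trans zero_less_one)
    also have "\<dots> = f (a + p * q + p)"
      using run[OF that, of "p - 1"] p by simp
    also have "\<dots> = a + p * q + 1"
      using le p by (simp add: f_def)
    finally show ?thesis .
  qed
  have fp: "(f ^^ p) i = i" for i
  proof (cases "a < i \<and> i \<le> n")
    case True
    define q j where "q = (i - a - 1) div p" and "j = (i - a - 1) mod p"
    have i: "i = a + p * q + 1 + j"
      using True by (simp add: q_def j_def)
    have "q < b"
      unfolding q_def using True p n by (intro less_mult_imp_div_less) (auto simp: mult.commute)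
    moreover have "j < p" using p by (simp add: j_def)
    ultimately have i': "i = (f ^^ j) (a + p * q + 1)"
      using run i by simp
    have "(f ^^ p) i = (f ^^ j) ((f ^^ p) (a + p * q + 1))"
      unfolding i' by (metis add.commute comp_apply funpow_add)
    also have "\<dots> = i"
      by (simp only: block[OF \<open>q < b\<close>] i')
    finally show ?thesis .
  next
    case False
    then have "f i = i" by (auto simp: f_def)
    then show ?thesis by (induction p) auto
  qed
  then have fp': "f ^^ p = id" by (simp add: fun_eq_iff)
  have "bij f"
  proof (rule o_bij)
    show "f ^^ (p - 1) \<circ> f = id"
      using fp' p by (metis Suc_diff_1 funpow_Suc_right less_trans zero_less_one)
    show "f \<circ> f ^^ (p - 1) = id"
      using fp' p by (metis Suc_diff_1 funpow.simps(2) less_trans zero_less_one)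
  qed
  then have "f permutes {1..n}"
    unfolding permutes_def bij_iff by (auto simp: f_def)
  moreover have "{i \<in> {1..n}. f i = i} = {1..a}"
    using p n by (auto simp: f_def dest: dvd_imp_le)
  ultimately show ?thesis
    using fp' by (auto simp: prime_order_perms_def)
qed

section \<open>Low records of a uniformly shuffled word\<close>

lemma low_rec_cong:
  assumes "\<And>i. i \<in> {1..k} \<Longrightarrow> f i = g i"
  shows "low_rec k f = low_rec k g"
  unfolding low_rec_def using assms by (intro arg_cong[where f = card]) auto

lemma low_rec_0 [simp]: "low_rec 0 f = 0"
  by (simp add: low_rec_def)

lemma low_rec_Suc:
  "low_rec (Suc k) f = low_rec k f + of_bool (\<forall>j\<in>{1..k}. f (Suc k) < f j)"
proof -
  let ?R = "{i \<in> {1..k}. \<forall>j\<in>{1..k}. j < i \<longrightarrow> f j > f i}"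
  have "{i \<in> {1..Suc k}. \<forall>j\<in>{1..Suc k}. j < i \<longrightarrow> f j > f i} =
      (if \<forall>j\<in>{1..k}. f (Suc k) < f j then insert (Suc k) ?R else ?R)"
    by (auto simp: le_Suc_eq)
  then show ?thesis
    by (simp add: low_rec_def)
qed

text \<open>The letter in the last position is a record exactly when it is the smallest one, and whichever it
  is, the positions before it carry all orderings of the other letters. Choosing the last letter thus
  contributes the factor \<open>x + (k - 1)\<close>: one choice creates a record, the others do not.\<close>

lemma sum_power_low_rec_permutations:
  fixes x :: "'a :: comm_semiring_1"
  assumes "inj_on v {1..k}"
  shows "(\<Sum>\<sigma> | \<sigma> permutes {1..k}. x ^ low_rec k (v \<circ> \<sigma>)) = (\<Prod>j=1..k. x + of_nat (j - 1))"
  using assms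
proof (induction k arbitrary: v)
  case 0
  then show ?case by simp
next
  case (Suc k)
  let ?P = "{\<sigma>. \<sigma> permutes {1..k}}"
  let ?w = "\<lambda>b. v \<circ> Transposition.transpose (Suc k) b"
  have ins: "{1..Suc k} = insert (Suc k) {1..k}" by auto
  let ?min = "\<lambda>b. \<forall>j\<in>{1..Suc k} - {b}. v b < v j"
  \<comment> \<open>\<open>?w b\<close> lists on \<open>{1..k}\<close> the letters that remain when position \<open>Suc k\<close> receives the letter \<open>v b\<close>.\<close>
  have last: "(\<Sum>q\<in>?P. x ^ low_rec (Suc k) (v \<circ> (Transposition.transpose (Suc k) b \<circ> q))) =
      x ^ of_bool (?min b) * (\<Prod>j=1..k. x + of_nat (j - 1))"
    if b: "b \<in> {1..Suc k}" for b
  proof -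
    have tr: "Transposition.transpose (Suc k) b permutes {1..Suc k}"
      using b by (intro permutes_swap_id) auto
    then have inj: "inj_on (?w b) {1..k}"
      using Suc.prems b
      by (intro comp_inj_on) (auto intro: inj_on_subset simp: permutes_inj_on inj_on_def Transposition.transpose_def)
    have img: "Transposition.transpose (Suc k) b ` {1..k} = {1..Suc k} - {b}"
    proof -
      have "Transposition.transpose (Suc k) b ` ({1..Suc k} - {Suc k}) = {1..Suc k} - {b}"
        using permutes_image[OF tr] by (subst image_set_diff[OF permutes_inj[OF tr]]) auto
      moreover have "{1..Suc k} - {Suc k} = {1..k}" by auto
      ultimately show ?thesis by simp
    qed
    have "low_rec (Suc k) (v \<circ> (Transposition.transpose (Suc k) b \<circ> q)) = low_rec k (?w b \<circ> q) + of_bool (?min b)"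
      if q: "q permutes {1..k}" for q
    proof -
      have "q (Suc k) = Suc k" using q by (simp add: permutes_def)
      then have "(\<forall>j\<in>{1..k}. (?w b \<circ> q) (Suc k) < (?w b \<circ> q) j) \<longleftrightarrow>
          (\<forall>j\<in>q ` {1..k}. v b < ?w b j)"
        by simp
      also have "\<dots> \<longleftrightarrow> (\<forall>j\<in>Transposition.transpose (Suc k) b ` {1..k}. v b < v j)"
        using permutes_image[OF q] by simp
      also have "\<dots> \<longleftrightarrow> ?min b"
        by (simp only: img)
      finally show ?thesis
        by (simp add: low_rec_Suc comp_assoc)
    qed
    then have "(\<Sum>q\<in>?P. x ^ low_rec (Suc k) (v \<circ> (Transposition.transpose (Suc k) b \<circ> q))) =
        (\<Sum>q\<in>?P. x ^ of_bool (?min b) * x ^ low_rec k (?w b \<circ> q))"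
      by (intro sum.cong) (auto simp: power_add mult.commute)
    also have "\<dots> = x ^ of_bool (?min b) * (\<Prod>j=1..k. x + of_nat (j - 1))"
      by (simp only: sum_distrib_left[symmetric] Suc.IH[OF inj])
    finally show ?thesis .
  qed
  define m where "m = (ARG_MIN v j. j \<in> {1..Suc k})"
  have m: "m \<in> {1..Suc k}" "\<And>j. j \<in> {1..Suc k} \<Longrightarrow> v m \<le> v j"
    using arg_min_nat_lemma[of "\<lambda>j. j \<in> {1..Suc k}" 1 v] unfolding m_def by auto
  have min_iff: "?min b \<longleftrightarrow> b = m" if "b \<in> {1..Suc k}" for b
  proof
    assume "?min b"
    then show "b = m" using m that by (metis Diff_iff leD singletonD)
  next
    assume "b = m"
    then show "?min b"
      using m Suc.prems by (metis Diff_iff inj_on_contraD le_neq_implies_less singletonI)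
  qed
  have "(\<Sum>\<sigma> | \<sigma> permutes {1..Suc k}. x ^ low_rec (Suc k) (v \<circ> \<sigma>)) =
      (\<Sum>b\<in>insert (Suc k) {1..k}. \<Sum>q\<in>?P. x ^ low_rec (Suc k) (v \<circ> (Transposition.transpose (Suc k) b \<circ> q)))"
    unfolding ins by (subst sum_over_permutations_insert) auto
  also have "\<dots> = (\<Sum>b\<in>{1..Suc k}. x ^ of_bool (b = m) * (\<Prod>j=1..k. x + of_nat (j - 1)))"
    unfolding ins[symmetric] by (intro sum.cong) (simp_all only: last min_iff)
  also have "\<dots> = (\<Sum>b\<in>{1..Suc k}. x ^ of_bool (b = m)) * (\<Prod>j=1..k. x + of_nat (j - 1))"
    by (simp only: sum_distrib_right)
  also have "(\<Sum>b\<in>{1..Suc k}. x ^ of_bool (b = m)) = x + (\<Sum>b\<in>{1..Suc k} - {m}. 1)"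
    using m(1) by (subst sum.remove[of _ m]) (auto intro!: sum.cong)
  also have "\<dots> = x + of_nat (Suc k - 1)"
    using m(1) by simp
  also have "(x + of_nat (Suc k - 1)) * (\<Prod>j=1..k. x + of_nat (j - 1)) = (\<Prod>j=1..Suc k. x + of_nat (j - 1))"
    by (simp add: prod.nat_ivl_Suc' mult.commute)
  finally show ?case .
qed

section \<open>Conjugation-invariant sets of permutations\<close>

text \<open>Apart from the number of fixed points, these symmetries are all that the estimates need; a uniform law
  on \<open>S\<close> is expressed by cardinalities of subsets of \<open>S\<close> and sums over \<open>S\<close>.\<close>

locale conjugation_invariant =
  fixes n :: nat and S :: "(nat \<Rightarrow> nat) set"
  assumes permutes: "\<tau> \<in> S \<Longrightarrow> \<tau> permutes {1..n}"
    and conj_in: "\<tau> \<in> S \<Longrightarrow> \<pi> permutes {1..n} \<Longrightarrow> \<pi> \<circ> \<tau> \<circ> inv \<pi> \<in> S"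
    and inv_in: "\<tau> \<in> S \<Longrightarrow> inv \<tau> \<in> S"
begin

lemma finite_S: "finite S"
  by (rule finite_subset[OF _ finite_permutations[of "{1..n}"]]) (auto dest: permutes)

lemma conj_inj: "inj_on (\<lambda>\<tau>. \<pi> \<circ> \<tau> \<circ> inv \<pi>) T" if "\<pi> permutes {1..n}"
proof (rule inj_onI)
  fix \<tau> \<tau>' assume "\<pi> \<circ> \<tau> \<circ> inv \<pi> = \<pi> \<circ> \<tau>' \<circ> inv \<pi>"
  then have "inv \<pi> \<circ> (\<pi> \<circ> \<tau> \<circ> inv \<pi>) \<circ> \<pi> = inv \<pi> \<circ> (\<pi> \<circ> \<tau>' \<circ> inv \<pi>) \<circ> \<pi>"
    by simp
  then show "\<tau> = \<tau>'"
    using permutes_inverses[OF that] by (simp add: fun_eq_iff)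
qed

lemma sum_conj:
  assumes T: "T \<subseteq> S" "\<And>\<tau>. \<tau> \<in> T \<Longrightarrow> \<pi> \<circ> \<tau> \<circ> inv \<pi> \<in> T" and \<pi>: "\<pi> permutes {1..n}"
  shows "(\<Sum>\<tau>\<in>T. f (\<pi> \<circ> \<tau> \<circ> inv \<pi>)) = (\<Sum>\<tau>\<in>T. f \<tau>)"
proof -
  have "finite T" using T(1) finite_S by (rule finite_subset)
  then have "(\<lambda>\<tau>. \<pi> \<circ> \<tau> \<circ> inv \<pi>) ` T = T"
    using T(2) conj_inj[OF \<pi>] by (intro endo_inj_surj) auto
  then have "(\<Sum>\<tau>\<in>T. f \<tau>) = (\<Sum>\<tau>\<in>(\<lambda>\<tau>. \<pi> \<circ> \<tau> \<circ> inv \<pi>) ` T. f \<tau>)" by simp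
  also have "\<dots> = (\<Sum>\<tau>\<in>T. f (\<pi> \<circ> \<tau> \<circ> inv \<pi>))"
    by (subst sum.reindex[OF conj_inj[OF \<pi>]]) simp
  finally show ?thesis ..
qed

lemma sum_conj_S:
  assumes "\<pi> permutes {1..n}"
  shows "(\<Sum>\<tau>\<in>S. f (\<pi> \<circ> \<tau> \<circ> inv \<pi>)) = (\<Sum>\<tau>\<in>S. f \<tau>)"
  using conj_in assms by (intro sum_conj) auto

text \<open>Conjugation by the transposition of \<open>j\<close> and \<open>j'\<close>, both different from \<open>i\<close>, shows that
  all values other than \<open>i\<close> itself are equally likely for \<open>\<tau> i\<close>.\<close>

lemma card_image_value:
  assumes "i \<in> {1..n}" "j \<in> {1..n}" "i \<noteq> j"
  shows "(n - 1) * card {\<tau> \<in> S. \<tau> i = j} \<le> card S"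
proof -
  have eq: "card {\<tau> \<in> S. \<tau> i = j'} = card {\<tau> \<in> S. \<tau> i = j}" if j': "j' \<in> {1..n} - {i}" for j'
  proof -
    let ?\<pi> = "Transposition.transpose j j'"
    have \<pi>: "?\<pi> permutes {1..n}" using assms j' by (intro permutes_swap_id) auto
    have "card {\<tau> \<in> S. \<tau> i = j'} = (\<Sum>\<tau>\<in>S. of_bool (\<tau> i = j'))"
      using finite_S by (simp add: Int_def)
    also have "\<dots> = (\<Sum>\<tau>\<in>S. of_bool ((?\<pi> \<circ> \<tau> \<circ> inv ?\<pi>) i = j'))"
      by (rule sum_conj_S[OF \<pi>, symmetric])
    also have "\<dots> = (\<Sum>\<tau>\<in>S. of_bool (\<tau> i = j))"
      using assms j' by (intro sum.cong) (auto simp: transpose_eq_iff)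
    also have "\<dots> = card {\<tau> \<in> S. \<tau> i = j}"
      using finite_S by (simp add: Int_def)
    finally show ?thesis .
  qed
  have "(n - 1) * card {\<tau> \<in> S. \<tau> i = j} = (\<Sum>j'\<in>{1..n} - {i}. card {\<tau> \<in> S. \<tau> i = j})"
    using assms by simp
  also have "\<dots> = (\<Sum>j'\<in>{1..n} - {i}. card {\<tau> \<in> S. \<tau> i = j'})"
    by (intro sum.cong refl eq[symmetric])
  also have "\<dots> = card (\<Union>j'\<in>{1..n} - {i}. {\<tau> \<in> S. \<tau> i = j'})"
    using finite_S by (subst card_UN_disjoint) auto
  also have "\<dots> \<le> card S"
    using finite_S by (intro card_mono) auto
  finally show ?thesis .
qed

text \<open>By conjugation every point is equally likely to be fixed, and there are \<open>a\<close> fixed points in total.\<close>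

lemma card_fixing:
  assumes "i \<in> {1..n}" and fixed: "\<And>\<tau>. \<tau> \<in> S \<Longrightarrow> card {i \<in> {1..n}. \<tau> i = i} = a"
  shows "n * card {\<tau> \<in> S. \<tau> i = i} = a * card S"
proof -
  have eq: "(\<Sum>\<tau>\<in>S. of_bool (\<tau> i' = i')) = card {\<tau> \<in> S. \<tau> i = i}" if i': "i' \<in> {1..n}" for i'
  proof -
    let ?\<pi> = "Transposition.transpose i i'"
    have \<pi>: "?\<pi> permutes {1..n}" using assms i' by (intro permutes_swap_id) auto
    have "(\<Sum>\<tau>\<in>S. of_bool (\<tau> i' = i') :: nat) = (\<Sum>\<tau>\<in>S. of_bool ((?\<pi> \<circ> \<tau> \<circ> inv ?\<pi>) i' = i'))"
      by (rule sum_conj_S[OF \<pi>, symmetric])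
    also have "\<dots> = (\<Sum>\<tau>\<in>S. of_bool (\<tau> i = i))"
      by (intro sum.cong) (auto simp: transpose_eq_iff)
    also have "\<dots> = card {\<tau> \<in> S. \<tau> i = i}"
      using finite_S by (simp add: Int_def)
    finally show ?thesis .
  qed
  have "n * card {\<tau> \<in> S. \<tau> i = i} = (\<Sum>i'\<in>{1..n}. \<Sum>\<tau>\<in>S. of_bool (\<tau> i' = i'))"
    using eq by simp
  also have "\<dots> = (\<Sum>\<tau>\<in>S. \<Sum>i'\<in>{1..n}. of_bool (\<tau> i' = i'))"
    by (rule sum.swap)
  also have "\<dots> = (\<Sum>\<tau>\<in>S. a)"
    using fixed by (intro sum.cong) (auto simp: Int_def)
  finally show ?thesis by (simp add: mult.commute)
qed

text \<open>The expected number of points of the graph in the square \<open>[1, m] \<times> [1, m]\<close>: the first term comes from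
  the diagonal, the second from the at most \<open>m\<^sup>2\<close> cells off the diagonal. It is used for \<open>m = k\<close>, to
  bound the probability of not being escaping, and for \<open>m = A\<close>, to bound the residual records.\<close>

lemma sum_card_square:
  assumes n: "n \<ge> 2" and m: "m \<le> n"
    and fixed: "\<And>\<tau>. \<tau> \<in> S \<Longrightarrow> card {i \<in> {1..n}. \<tau> i = i} = a"
  shows "(\<Sum>\<tau>\<in>S. real (card {i \<in> {1..m}. \<tau> i \<le> m}))
           \<le> (real m * real a / real n + (real m)\<^sup>2 / (real n - 1)) * real (card S)"
proof -
  have pos: "real n - 1 > 0" "real n > 0" using n by auto
  have off_diagonal: "real (card {\<tau> \<in> S. \<tau> i = j}) \<le> real (card S) / (real n - 1)"
    if "i \<in> {1..m}" "j \<in> {1..m}" "i \<noteq> j" for i j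
  proof -
    have "real ((n - 1) * card {\<tau> \<in> S. \<tau> i = j}) \<le> real (card S)"
      using that m by (intro of_nat_mono card_image_value) auto
    then show ?thesis using n pos by (simp add: field_simps of_nat_diff)
  qed
  have fixing: "real (card {\<tau> \<in> S. \<tau> i = i}) = real a * real (card S) / real n" if "i \<in> {1..m}" for i
  proof -
    have "real (n * card {\<tau> \<in> S. \<tau> i = i}) = real (a * card S)"
      using that m fixed by (subst card_fixing) auto
    then show ?thesis using n by (simp add: field_simps)
  qed
  have "(\<Sum>\<tau>\<in>S. real (card {i \<in> {1..m}. \<tau> i \<le> m}))
      = (\<Sum>\<tau>\<in>S. \<Sum>i=1..m. \<Sum>j=1..m. of_bool (\<tau> i = j))"
  proof (intro sum.cong refl)
    fix \<tau> assume "\<tau> \<in> S"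
    have "(\<Sum>j=1..m. of_bool (\<tau> i = j)) = (of_bool (\<tau> i \<le> m) :: real)" if "i \<in> {1..m}" for i
    proof -
      have "\<tau> i \<in> {1..n}"
        using permutes_in_image[OF permutes[OF \<open>\<tau> \<in> S\<close>], of i] that m by auto
      then show ?thesis by (simp add: of_bool_def)
    qed
    then have "(\<Sum>i=1..m. \<Sum>j=1..m. of_bool (\<tau> i = j)) = (\<Sum>i=1..m. of_bool (\<tau> i \<le> m) :: real)"
      by (intro sum.cong) auto
    then show "real (card {i \<in> {1..m}. \<tau> i \<le> m}) = (\<Sum>i=1..m. \<Sum>j=1..m. of_bool (\<tau> i = j))"
      by (simp add: Int_def)
  qed
  also have "\<dots> = (\<Sum>i=1..m. \<Sum>j=1..m. \<Sum>\<tau>\<in>S. of_bool (\<tau> i = j))"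
    by (subst sum.swap, intro sum.cong refl, subst sum.swap) simp
  also have "\<dots> = (\<Sum>i=1..m. \<Sum>j=1..m. real (card {\<tau> \<in> S. \<tau> i = j}))"
    using finite_S by (simp add: Int_def)
  also have "\<dots> \<le> (\<Sum>i=1..m. real a * real (card S) / real n + real m * (real (card S) / (real n - 1)))"
  proof (intro sum_mono)
    fix i assume i: "i \<in> {1..m}"
    have "(\<Sum>j=1..m. real (card {\<tau> \<in> S. \<tau> i = j})) =
        real (card {\<tau> \<in> S. \<tau> i = i}) + (\<Sum>j\<in>{1..m} - {i}. real (card {\<tau> \<in> S. \<tau> i = j}))"
      using i by (subst sum.remove[of _ i]) auto
    also have "\<dots> \<le> real a * real (card S) / real n + (\<Sum>j\<in>{1..m} - {i}. real (card S) / (real n - 1))"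
      using i fixing off_diagonal by (intro add_mono sum_mono) auto
    also have "\<dots> \<le> real a * real (card S) / real n + (\<Sum>j\<in>{1..m}. real (card S) / (real n - 1))"
      using pos by (intro add_left_mono sum_mono2) auto
    finally show "(\<Sum>j=1..m. real (card {\<tau> \<in> S. \<tau> i = j}))
        \<le> real a * real (card S) / real n + real m * (real (card S) / (real n - 1))"
      by simp
  qed
  also have "\<dots> = (real m * real a / real n + (real m)\<^sup>2 / (real n - 1)) * real (card S)"
    by (simp add: algebra_simps power2_eq_square)
  finally show ?thesis .
qed

text \<open>For an escaping permutation the points with position at most \<open>k\<close> and those with value at most \<open>k\<close>
  are disjoint, and the symmetric group on \<open>{1..k}\<close> can act on the former.\<close>

definition escaping :: "nat \<Rightarrow> (nat \<Rightarrow> nat) set" where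
  "escaping k = {\<tau> \<in> S. \<forall>i\<in>{1..k}. k < \<tau> i}"

lemma escaping_subset: "escaping k \<subseteq> S"
  by (auto simp: escaping_def)

lemma finite_escaping: "finite (escaping k)"
  using escaping_subset finite_S by (rule finite_subset)

lemma card_not_escaping:
  "real (card (S - escaping k)) \<le> (\<Sum>\<tau>\<in>S. real (card {i \<in> {1..k}. \<tau> i \<le> k}))"
proof -
  have "real (card (S - escaping k)) = (\<Sum>\<tau>\<in>S - escaping k. 1)" by simp
  also have "\<dots> \<le> (\<Sum>\<tau>\<in>S - escaping k. real (card {i \<in> {1..k}. \<tau> i \<le> k}))"
  proof (intro sum_mono)
    fix \<tau> assume "\<tau> \<in> S - escaping k"
    then have "{i \<in> {1..k}. \<tau> i \<le> k} \<noteq> {}" by (auto simp: escaping_def not_less)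
    then have "card {i \<in> {1..k}. \<tau> i \<le> k} > 0" by (subst card_gt_0_iff) auto
    then show "1 \<le> real (card {i \<in> {1..k}. \<tau> i \<le> k})" by simp
  qed
  also have "\<dots> \<le> (\<Sum>\<tau>\<in>S. real (card {i \<in> {1..k}. \<tau> i \<le> k}))"
    using finite_S by (intro sum_mono2) auto
  finally show ?thesis .
qed

lemma inv_escaping:
  assumes "\<tau> \<in> escaping k"
  shows "inv \<tau> \<in> escaping k"
proof -
  have \<tau>: "\<tau> \<in> S" "\<tau> permutes {1..n}" and esc: "\<And>i. i \<in> {1..k} \<Longrightarrow> k < \<tau> i"
    using assms permutes by (auto simp: escaping_def)
  have "k < inv \<tau> i" if "i \<in> {1..k}" for i
  proof (rule ccontr)
    assume "\<not> k < inv \<tau> i"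
    moreover have "inv \<tau> i \<noteq> 0"
    proof
      assume "inv \<tau> i = 0"
      then have "i = \<tau> 0" using permutes_inverses(1)[OF \<tau>(2), of i] by simp
      then show False using \<tau>(2) that by (simp add: permutes_def)
    qed
    ultimately have "k < \<tau> (inv \<tau> i)" by (intro esc) auto
    then show False using permutes_inverses(1)[OF \<tau>(2)] that by simp
  qed
  then show ?thesis using inv_in[OF \<tau>(1)] by (simp add: escaping_def)
qed

lemma sum_escaping_inv: "(\<Sum>\<tau>\<in>escaping k. f (inv \<tau>)) = (\<Sum>\<tau>\<in>escaping k. f \<tau>)"
proof -
  have "inv (inv \<tau>) = \<tau>" if "\<tau> \<in> escaping k" for \<tau>
    using that permutes_inv_inv[OF permutes] by (auto simp: escaping_def)
  then show ?thesis
    by (intro sum.reindex_bij_witness[of _ inv inv]) (auto intro: inv_escaping)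
qed

end

section \<open>Exchangeability of the head of the permutation\<close>

context conjugation_invariant
begin

text \<open>A shuffle of the word \<open>\<tau> 1, \<dots>, \<tau> k\<close> has to be a conjugation in order to stay inside \<open>S\<close>. The
  permutation \<open>\<tau> \<circ> \<sigma> \<circ> inv \<tau>\<close> moves only letters of that word, sending \<open>\<tau> i\<close> to \<open>\<tau> (\<sigma> i)\<close>; it fixes
  \<open>{1..k}\<close> when \<open>\<tau>\<close> is escaping.\<close>

definition shuffle_images :: "(nat \<Rightarrow> nat) \<Rightarrow> (nat \<Rightarrow> nat) \<Rightarrow> nat \<Rightarrow> nat" where
  "shuffle_images \<sigma> \<tau> = (let \<pi> = \<tau> \<circ> \<sigma> \<circ> inv \<tau> in \<pi> \<circ> \<tau> \<circ> inv \<pi>)"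

context
  fixes k \<sigma>
  assumes k: "k \<le> n" and \<sigma>: "\<sigma> permutes {1..k}"
begin

lemma shuffle_conj_permutes:
  assumes "\<tau> \<in> S"
  shows "\<tau> \<circ> \<sigma> \<circ> inv \<tau> permutes {1..n}"
proof -
  have "\<sigma> permutes {1..n}" by (rule permutes_subset[OF \<sigma>]) (use k in auto)
  then show ?thesis
    using permutes[OF assms] by (intro permutes_compose permutes_inv)
qed

lemma shuffle_conj_fixes:
  assumes "\<tau> \<in> S" "x \<notin> \<tau> ` {1..k}"
  shows "(\<tau> \<circ> \<sigma> \<circ> inv \<tau>) x = x" "inv (\<tau> \<circ> \<sigma> \<circ> inv \<tau>) x = x"
proof -
  have "inv \<tau> x \<notin> {1..k}"
    using assms permutes_inverses(1)[OF permutes[OF assms(1)], of x] by (metis image_eqI)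
  then show 1: "(\<tau> \<circ> \<sigma> \<circ> inv \<tau>) x = x"
    using \<sigma> permutes_inverses(1)[OF permutes[OF assms(1)], of x] by (simp add: permutes_def)
  then show "inv (\<tau> \<circ> \<sigma> \<circ> inv \<tau>) x = x"
    using permutes_inverses(2)[OF shuffle_conj_permutes[OF assms(1)], of x] by simp
qed

lemma shuffle_images_apply:
  assumes \<tau>: "\<tau> \<in> escaping k" and i: "i \<in> {1..k}"
  shows "shuffle_images \<sigma> \<tau> i = \<tau> (\<sigma> i)"
proof -
  have S: "\<tau> \<in> S" using \<tau> by (simp add: escaping_def)
  have "i \<notin> \<tau> ` {1..k}" using \<tau> i by (auto simp: escaping_def dest: leD)
  then have "inv (\<tau> \<circ> \<sigma> \<circ> inv \<tau>) i = i"
    by (rule shuffle_conj_fixes(2)[OF S])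
  then show ?thesis
    using permutes_inverses(2)[OF permutes[OF S]] by (simp add: shuffle_images_def Let_def)
qed

text \<open>The word of preimages is unaffected as long as it uses none of the letters being shuffled. This fails
  for involutions, and it is the source of independence for permutations of order three.\<close>

lemma inv_shuffle_images_apply:
  assumes \<tau>: "\<tau> \<in> escaping k" and i: "i \<in> {1..k}" and "inv \<tau> i \<notin> \<tau> ` {1..k}"
  shows "inv (shuffle_images \<sigma> \<tau>) i = inv \<tau> i"
proof -
  have S: "\<tau> \<in> S" using \<tau> by (simp add: escaping_def)
  have ni: "i \<notin> \<tau> ` {1..k}" using \<tau> i by (auto simp: escaping_def dest: leD)
  let ?\<pi> = "\<tau> \<circ> \<sigma> \<circ> inv \<tau>"
  have \<pi>: "?\<pi> permutes {1..n}" by (rule shuffle_conj_permutes[OF S])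
  have "shuffle_images \<sigma> \<tau> (inv \<tau> i) = i"
    using shuffle_conj_fixes[OF S assms(3)] shuffle_conj_fixes[OF S ni]
      permutes_inverses(1)[OF permutes[OF S], of i]
    by (simp add: shuffle_images_def Let_def)
  moreover have "shuffle_images \<sigma> \<tau> permutes {1..n}"
    unfolding shuffle_images_def Let_def by (rule permutes[OF conj_in[OF S \<pi>]])
  ultimately show ?thesis
    using permutes_inverses(2) by metis
qed

lemma shuffle_images_in: "shuffle_images \<sigma> \<tau> \<in> escaping k" if "\<tau> \<in> escaping k"
proof -
  have "\<tau> \<in> S" using that by (simp add: escaping_def)
  then have "shuffle_images \<sigma> \<tau> \<in> S"
    unfolding shuffle_images_def Let_def by (intro conj_in shuffle_conj_permutes)
  moreover have "k < shuffle_images \<sigma> \<tau> i" if "i \<in> {1..k}" for i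
    using \<open>\<tau> \<in> escaping k\<close> that permutes_in_image[OF \<sigma>]
    by (simp only: shuffle_images_apply) (simp add: escaping_def)
  ultimately show ?thesis by (simp add: escaping_def)
qed

text \<open>The shuffled permutation determines \<open>\<tau>\<close> on \<open>{1..k}\<close>, hence the conjugating permutation
  \<open>\<tau> \<circ> \<sigma> \<circ> inv \<tau>\<close>, hence \<open>\<tau>\<close>.\<close>

lemma inj_on_shuffle_images: "inj_on (shuffle_images \<sigma>) (escaping k)"
proof (rule inj_onI)
  fix \<tau> \<tau>' assume \<tau>: "\<tau> \<in> escaping k" and \<tau>': "\<tau>' \<in> escaping k"
    and eq: "shuffle_images \<sigma> \<tau> = shuffle_images \<sigma> \<tau>'"
  have S: "\<tau> \<in> S" "\<tau>' \<in> S" using \<tau> \<tau>' by (auto simp: escaping_def)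
  have agree: "\<tau> i = \<tau>' i" if "i \<in> {1..k}" for i
  proof -
    have "inv \<sigma> i \<in> {1..k}"
      using that permutes_in_image[OF permutes_inv[OF \<sigma>]] by blast
    then show ?thesis
      using shuffle_images_apply[OF \<tau>] shuffle_images_apply[OF \<tau>'] eq
        permutes_inverses(1)[OF \<sigma>, of i] by metis
  qed
  have "(\<tau> \<circ> \<sigma> \<circ> inv \<tau>) x = (\<tau>' \<circ> \<sigma> \<circ> inv \<tau>') x" for x
  proof (cases "x \<in> \<tau> ` {1..k}")
    case True
    then obtain i where i: "i \<in> {1..k}" "x = \<tau> i" by auto
    have "\<sigma> i \<in> {1..k}" using i permutes_in_image[OF \<sigma>] by blast
    then have "\<tau> (\<sigma> i) = \<tau>' (\<sigma> i)" by (rule agree)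
    moreover have "inv \<tau> x = i" "inv \<tau>' x = i"
      using i agree[OF i(1)] permutes_inverses(2)[OF permutes[OF S(1)]]
        permutes_inverses(2)[OF permutes[OF S(2)]] by metis+
    ultimately show ?thesis by simp
  next
    case False
    moreover have "\<tau> ` {1..k} = \<tau>' ` {1..k}" using agree by (intro image_cong) auto
    ultimately have "x \<notin> \<tau>' ` {1..k}" by blast
    then show ?thesis
      using False shuffle_conj_fixes(1) S by metis
  qed
  then have "\<tau> \<circ> \<sigma> \<circ> inv \<tau> = \<tau>' \<circ> \<sigma> \<circ> inv \<tau>'" by auto
  then show "\<tau> = \<tau>'"
    using eq conj_inj[OF shuffle_conj_permutes[OF S(1)], of UNIV]
    by (auto simp: shuffle_images_def Let_def inj_on_def)
qed

lemma sum_shuffle_images: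
  "(\<Sum>\<tau>\<in>escaping k. f (shuffle_images \<sigma> \<tau>)) = (\<Sum>\<tau>\<in>escaping k. f \<tau>)"
proof -
  have "shuffle_images \<sigma> ` escaping k = escaping k"
    using finite_escaping shuffle_images_in inj_on_shuffle_images
    by (intro endo_inj_surj) auto
  then show ?thesis
    using sum.reindex[OF inj_on_shuffle_images, of f] by simp
qed

end

text \<open>Under the uniform law on escaping permutations, the record count of the head is independent of every
  shuffle-invariant statistic \<open>G\<close>: averaging over all shuffles \<open>\<sigma>\<close> turns the left-hand side into
  the generating function of \<open>sum_power_low_rec_permutations\<close>, separately for each \<open>\<tau>\<close>.\<close>

lemma sum_power_low_rec_escaping:
  fixes x :: "'a :: {comm_semiring_1, semiring_char_0}"
  assumes k: "k \<le> n"
    and G: "\<And>\<tau> \<sigma>. \<tau> \<in> escaping k \<Longrightarrow> \<sigma> permutes {1..k} \<Longrightarrow> G (shuffle_images \<sigma> \<tau>) = G \<tau>"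
  shows "fact k * (\<Sum>\<tau>\<in>escaping k. x ^ low_rec k \<tau> * G \<tau>)
           = (\<Prod>j=1..k. x + of_nat (j - 1)) * (\<Sum>\<tau>\<in>escaping k. G \<tau>)"
proof -
  let ?P = "{\<sigma>. \<sigma> permutes {1..k}}"
  have shuffled: "(\<Sum>\<tau>\<in>escaping k. x ^ low_rec k \<tau> * G \<tau>) =
      (\<Sum>\<tau>\<in>escaping k. x ^ low_rec k (\<tau> \<circ> \<sigma>) * G \<tau>)" if "\<sigma> \<in> ?P" for \<sigma>
  proof -
    have \<sigma>: "\<sigma> permutes {1..k}" using that by simp
    have "(\<Sum>\<tau>\<in>escaping k. x ^ low_rec k \<tau> * G \<tau>) =
        (\<Sum>\<tau>\<in>escaping k. x ^ low_rec k (shuffle_images \<sigma> \<tau>) * G (shuffle_images \<sigma> \<tau>))"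
      by (rule sum_shuffle_images[OF k \<sigma>, symmetric])
    also have "\<dots> = (\<Sum>\<tau>\<in>escaping k. x ^ low_rec k (\<tau> \<circ> \<sigma>) * G \<tau>)"
    proof (intro sum.cong refl)
      fix \<tau> assume \<tau>: "\<tau> \<in> escaping k"
      have "low_rec k (shuffle_images \<sigma> \<tau>) = low_rec k (\<tau> \<circ> \<sigma>)"
        using shuffle_images_apply[OF k \<sigma> \<tau>] by (intro low_rec_cong) simp
      then show "x ^ low_rec k (shuffle_images \<sigma> \<tau>) * G (shuffle_images \<sigma> \<tau>) =
          x ^ low_rec k (\<tau> \<circ> \<sigma>) * G \<tau>"
        using G[OF \<tau> \<sigma>] by simp
    qed
    finally show ?thesis .
  qed
  have "fact k * (\<Sum>\<tau>\<in>escaping k. x ^ low_rec k \<tau> * G \<tau>) =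
      (\<Sum>\<sigma>\<in>?P. \<Sum>\<tau>\<in>escaping k. x ^ low_rec k \<tau> * G \<tau>)"
    using card_permutations[of "{1..k}" k] by simp
  also have "\<dots> = (\<Sum>\<sigma>\<in>?P. \<Sum>\<tau>\<in>escaping k. x ^ low_rec k (\<tau> \<circ> \<sigma>) * G \<tau>)"
    by (rule sum.cong[OF refl shuffled])
  also have "\<dots> = (\<Sum>\<tau>\<in>escaping k. \<Sum>\<sigma>\<in>?P. x ^ low_rec k (\<tau> \<circ> \<sigma>) * G \<tau>)"
    by (rule sum.swap)
  also have "\<dots> = (\<Sum>\<tau>\<in>escaping k. (\<Prod>j=1..k. x + of_nat (j - 1)) * G \<tau>)"
  proof (intro sum.cong refl)
    fix \<tau> assume "\<tau> \<in> escaping k"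
    then have "inj \<tau>" using permutes_inj[OF permutes] by (auto simp: escaping_def)
    then have "inj_on \<tau> {1..k}" by (rule inj_on_subset) auto
    then show "(\<Sum>\<sigma>\<in>?P. x ^ low_rec k (\<tau> \<circ> \<sigma>) * G \<tau>) = (\<Prod>j=1..k. x + of_nat (j - 1)) * G \<tau>"
      using sum_power_low_rec_permutations[of \<tau> k x] by (simp only: sum_distrib_right[symmetric])
  qed
  finally show ?thesis by (simp only: sum_distrib_left[symmetric])
qed

text \<open>Conjugation by permutations of \<open>{k<..n}\<close> shows that the set of letters of the head word is
  equally likely to avoid \<open>B\<close> or any other subset of the same size; double counting the pairs of an
  escaping permutation and an avoided subset then gives the probability exactly.\<close>

lemma card_escaping_avoiding:
  assumes B: "B \<subseteq> {k<..n}" and k: "k \<le> n"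
  shows "((n - k) choose card B) * card {\<tau> \<in> escaping k. \<tau> ` {1..k} \<inter> B = {}}
           = ((n - 2 * k) choose card B) * card (escaping k)"
proof -
  let ?b = "card B"
  have finB: "finite B" using B by (rule finite_subset) simp
  let ?\<B> = "{B'. B' \<subseteq> {k<..n} \<and> card B' = ?b}"
  have eq: "card {\<tau> \<in> escaping k. \<tau> ` {1..k} \<inter> B = {}} =
      card {\<tau> \<in> escaping k. \<tau> ` {1..k} \<inter> B' = {}}" if B': "B' \<in> ?\<B>" for B'
  proof -
    have finB': "finite B'" using B' by (auto intro: finite_subset)
    \<comment> \<open>A permutation of \<open>{k<..n}\<close> carrying \<open>B\<close> to \<open>B'\<close> is glued from bijections of the sets and of their complements.\<close>
    obtain h where h: "bij_betw h B B'"
      using finite_same_card_bij[OF finB finB'] B' by auto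
    have "card ({k<..n} - B) = card ({k<..n} - B')"
      using B B' finB finB' by (simp add: card_Diff_subset)
    then obtain g where g: "bij_betw g ({k<..n} - B) ({k<..n} - B')"
      using finite_same_card_bij[of "{k<..n} - B" "{k<..n} - B'"] by auto
    define \<pi> where "\<pi> x = (if x \<in> B then h x else if x \<in> {k<..n} then g x else x)" for x
    have 1: "bij_betw \<pi> B B'"
      using h by (rule bij_betw_cong[THEN iffD1, rotated]) (simp add: \<pi>_def)
    have 2: "bij_betw \<pi> ({k<..n} - B) ({k<..n} - B')"
      using g by (rule bij_betw_cong[THEN iffD1, rotated]) (simp add: \<pi>_def)
    have "bij_betw \<pi> (B \<union> ({k<..n} - B)) (B' \<union> ({k<..n} - B'))"
      by (rule bij_betw_combine[OF 1 2]) auto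
    moreover have "B \<union> ({k<..n} - B) = {k<..n}" "B' \<union> ({k<..n} - B') = {k<..n}"
      using B B' by auto
    ultimately have perm_k: "\<pi> permutes {k<..n}"
      using B by (intro bij_imp_permutes) (auto simp: \<pi>_def)
    then have perm: "\<pi> permutes {1..n}"
      by (rule permutes_subset) auto
    have fix_k: "inv \<pi> i = i" if "i \<in> {1..k}" for i
      using permutes_inv[OF perm_k] that by (simp add: permutes_def)
    have closed: "\<pi> \<circ> \<tau> \<circ> inv \<pi> \<in> escaping k" if "\<tau> \<in> escaping k" for \<tau>
    proof -
      have "k < \<pi> (\<tau> (inv \<pi> i))" if "i \<in> {1..k}" for i
      proof -
        have \<tau>: "\<tau> permutes {1..n}" "k < \<tau> i"
          using \<open>\<tau> \<in> escaping k\<close> that permutes by (auto simp: escaping_def)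
        have "\<tau> i \<in> {1..n}" using permutes_in_image[OF \<tau>(1), of i] that k by auto
        then have "\<tau> i \<in> {k<..n}" using \<tau> by auto
        then have "\<pi> (\<tau> i) \<in> {k<..n}" using permutes_in_image[OF perm_k] by blast
        then show ?thesis using fix_k[OF that] by simp
      qed
      then show ?thesis using that conj_in[OF _ perm] by (simp add: escaping_def)
    qed
    have "card {\<tau> \<in> escaping k. \<tau> ` {1..k} \<inter> B' = {}} =
        (\<Sum>\<tau>\<in>escaping k. of_bool (\<tau> ` {1..k} \<inter> B' = {}))"
      using finite_escaping by (simp add: Int_def)
    also have "\<dots> = (\<Sum>\<tau>\<in>escaping k. of_bool ((\<pi> \<circ> \<tau> \<circ> inv \<pi>) ` {1..k} \<inter> B' = {}))"
      by (rule sum_conj[OF escaping_subset closed perm, symmetric])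
    also have "\<dots> = (\<Sum>\<tau>\<in>escaping k. of_bool (\<tau> ` {1..k} \<inter> B = {}))"
    proof (intro sum.cong refl arg_cong[where f = of_bool])
      fix \<tau>
      have "(\<pi> \<circ> \<tau> \<circ> inv \<pi>) ` {1..k} = \<pi> ` \<tau> ` {1..k}"
        using fix_k by (auto simp: image_image)
      moreover have "\<pi> ` B = B'" using 1 by (simp add: bij_betw_def)
      ultimately have "(\<pi> \<circ> \<tau> \<circ> inv \<pi>) ` {1..k} \<inter> B' = \<pi> ` (\<tau> ` {1..k} \<inter> B)"
        using image_Int[OF permutes_inj[OF perm]] by simp
      then show "((\<pi> \<circ> \<tau> \<circ> inv \<pi>) ` {1..k} \<inter> B' = {}) = (\<tau> ` {1..k} \<inter> B = {})"
        by simp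
    qed
    also have "\<dots> = card {\<tau> \<in> escaping k. \<tau> ` {1..k} \<inter> B = {}}"
      using finite_escaping by (simp add: Int_def)
    finally show ?thesis ..
  qed
  have card\<B>: "card ?\<B> = (n - k) choose ?b"
    by (subst n_subsets) auto
  have fin\<B>: "finite ?\<B>"
    by (rule finite_subset[of _ "Pow {k<..n}"]) auto
  have missed: "card {B' \<in> ?\<B>. \<tau> ` {1..k} \<inter> B' = {}} = (n - 2 * k) choose ?b"
    if "\<tau> \<in> escaping k" for \<tau>
  proof -
    have \<tau>: "\<tau> permutes {1..n}" "\<And>i. i \<in> {1..k} \<Longrightarrow> k < \<tau> i"
      using that permutes by (auto simp: escaping_def)
    have "\<tau> ` {1..k} \<subseteq> {k<..n}"
    proof
      fix y assume "y \<in> \<tau> ` {1..k}"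
      then obtain i where i: "i \<in> {1..k}" "y = \<tau> i" by auto
      have "\<tau> i \<in> {1..n}" using permutes_in_image[OF \<tau>(1), of i] i k by auto
      then show "y \<in> {k<..n}" using i \<tau>(2) by auto
    qed
    moreover have "card (\<tau> ` {1..k}) = k"
      using card_image[OF inj_on_subset[OF permutes_inj[OF \<tau>(1)]], of "{1..k}"] by simp
    ultimately have "card ({k<..n} - \<tau> ` {1..k}) = n - 2 * k"
      by (subst card_Diff_subset) auto
    moreover have "{B' \<in> ?\<B>. \<tau> ` {1..k} \<inter> B' = {}} =
        {B'. B' \<subseteq> {k<..n} - \<tau> ` {1..k} \<and> card B' = ?b}" by auto
    ultimately show ?thesis by (simp add: n_subsets)
  qed
  have "((n - k) choose ?b) * card {\<tau> \<in> escaping k. \<tau> ` {1..k} \<inter> B = {}} =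
      (\<Sum>B'\<in>?\<B>. card {\<tau> \<in> escaping k. \<tau> ` {1..k} \<inter> B = {}})"
    using card\<B> by simp
  also have "\<dots> = (\<Sum>B'\<in>?\<B>. card {\<tau> \<in> escaping k. \<tau> ` {1..k} \<inter> B' = {}})"
    by (intro sum.cong refl eq)
  also have "\<dots> = (\<Sum>B'\<in>?\<B>. \<Sum>\<tau>\<in>escaping k. of_bool (\<tau> ` {1..k} \<inter> B' = {}))"
    using finite_escaping by (simp add: Int_def)
  also have "\<dots> = (\<Sum>\<tau>\<in>escaping k. \<Sum>B'\<in>?\<B>. of_bool (\<tau> ` {1..k} \<inter> B' = {}))"
    by (rule sum.swap)
  also have "\<dots> = (\<Sum>\<tau>\<in>escaping k. card {B' \<in> ?\<B>. \<tau> ` {1..k} \<inter> B' = {}})"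
    using fin\<B> by (simp add: Int_def)
  also have "\<dots> = (\<Sum>\<tau>\<in>escaping k. (n - 2 * k) choose ?b)"
    by (intro sum.cong refl missed)
  finally show ?thesis by (simp add: mult.commute)
qed

end

section \<open>Low records split into position-small and value-small ones\<close>

lemma binomial_ratio_le_power:
  assumes "a \<le> b"
  shows "(a choose m) * b ^ m \<le> (b choose m) * a ^ m"
proof (induction m)
  case (Suc m)
  have step: "Suc m * (c choose Suc m) = (c choose m) * (c - m)" for c :: nat
    using binomial_absorb_comp[of c m] binomial_absorption[of m c]
    by (simp add: mult.commute)
  have "Suc m * ((a choose Suc m) * b ^ Suc m) = ((a choose m) * b ^ m) * ((a - m) * b)"
    using step[of a] by (simp only: power_Suc mult.assoc[symmetric]) (simp add: mult_ac)
  also have "\<dots> \<le> ((b choose m) * a ^ m) * ((b - m) * a)"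
  proof (rule mult_le_mono[OF Suc.IH])
    show "(a - m) * b \<le> (b - m) * a"
      using assms by (simp add: diff_mult_distrib mult.commute[of b a] diff_le_mono2)
  qed
  also have "\<dots> = Suc m * ((b choose Suc m) * a ^ Suc m)"
    using step[of b] by (simp only: power_Suc mult.assoc[symmetric]) (simp add: mult_ac)
  finally show ?case by (simp only: Suc_mult_le_cancel1)
qed simp

context conjugation_invariant
begin

text \<open>Let \<open>R\<close> be the set of record positions, \<open>P\<close> those of the word \<open>\<tau> 1, \<dots>, \<tau> k\<close>, and \<open>Q\<close> those of
  \<open>inv \<tau> 1, \<dots>, inv \<tau> k\<close>. A low record is a point of the graph with no other point to its lower left, a
  notion symmetric in position and value; this identifies \<open>P\<close> and \<open>inv \<tau> ` Q\<close> with the elements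
  of \<open>R\<close> of small position and of small value. Any other record lies to the right of the point
  \<open>(i\<^sub>0, \<tau> i\<^sub>0)\<close> and above the point \<open>(inv \<tau> j\<^sub>0, j\<^sub>0)\<close>; as neither point is to its lower left, its
  value is less than \<open>\<tau> i\<^sub>0\<close> and its position is at most \<open>inv \<tau> j\<^sub>0\<close>.\<close>

lemma low_rec_escaping_bounds:
  assumes \<tau>: "\<tau> \<in> escaping k" and k: "k \<le> n"
  shows low_rec_escaping_ge: "low_rec k \<tau> + low_rec k (inv \<tau>) \<le> low_rec n \<tau>"
    and low_rec_escaping_le: "\<lbrakk>i\<^sub>0 \<in> {1..k}; \<tau> i\<^sub>0 \<le> A; j\<^sub>0 \<in> {1..k}; inv \<tau> j\<^sub>0 \<le> A\<rbrakk> \<Longrightarrow>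
      low_rec n \<tau> \<le> low_rec k \<tau> + low_rec k (inv \<tau>) + card {i \<in> {1..A}. \<tau> i \<le> A}"
proof -
  have perm: "\<tau> permutes {1..n}" and esc: "\<And>i. i \<in> {1..k} \<Longrightarrow> k < \<tau> i"
    and esc': "\<And>i. i \<in> {1..k} \<Longrightarrow> k < inv \<tau> i"
    using \<tau> inv_escaping[OF \<tau>] permutes by (auto simp: escaping_def)
  note inv1 = permutes_inverses(1)[OF perm] and inv2 = permutes_inverses(2)[OF perm]
  have in_iff: "\<tau> i \<in> {1..n} \<longleftrightarrow> i \<in> {1..n}" for i
    by (rule permutes_in_image[OF perm])
  define R where "R = {i \<in> {1..n}. \<forall>j\<in>{1..n}. j < i \<longrightarrow> \<tau> j > \<tau> i}"
  define P where "P = {i \<in> {1..k}. \<forall>j\<in>{1..k}. j < i \<longrightarrow> \<tau> j > \<tau> i}"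
  define Q where "Q = {i \<in> {1..k}. \<forall>j\<in>{1..k}. j < i \<longrightarrow> inv \<tau> j > inv \<tau> i}"
  have fin: "finite P" "finite Q" "finite R" by (auto simp: P_def Q_def R_def)
  have P: "P = {i \<in> R. i \<le> k}"
    using k by (auto simp: P_def R_def)
  have Q: "inv \<tau> ` Q = {i \<in> R. \<tau> i \<le> k}"
  proof (intro equalityI subsetI)
    fix i assume "i \<in> inv \<tau> ` Q"
    then obtain v where v: "v \<in> Q" "i = inv \<tau> v" by auto
    then have \<tau>i: "\<tau> i = v" and vk: "v \<in> {1..k}" using inv1 by (auto simp: Q_def)
    have "\<tau> j > \<tau> i" if j: "j \<in> {1..n}" "j < i" for j
    proof (rule ccontr)
      assume "\<not> \<tau> j > \<tau> i"
      moreover have "\<tau> j \<noteq> \<tau> i" using j permutes_inj[OF perm] by (auto dest: injD)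
      ultimately have "\<tau> j < v" using \<tau>i by simp
      moreover have "\<tau> j \<in> {1..k}" using \<open>\<tau> j < v\<close> vk in_iff[of j] j by auto
      ultimately have "inv \<tau> (\<tau> j) > inv \<tau> v" using v(1) by (auto simp: Q_def)
      then show False using j v inv2 by simp
    qed
    moreover have "i \<in> {1..n}" using in_iff[of i] \<tau>i vk k by auto
    ultimately show "i \<in> {i \<in> R. \<tau> i \<le> k}" using \<tau>i vk by (auto simp: R_def)
  next
    fix i assume i: "i \<in> {i \<in> R. \<tau> i \<le> k}"
    then have "\<tau> i \<in> {1..k}" using in_iff[of i] by (auto simp: R_def)
    moreover have "inv \<tau> j > inv \<tau> (\<tau> i)" if j: "j \<in> {1..k}" "j < \<tau> i" for j
    proof (rule ccontr)
      assume "\<not> inv \<tau> j > inv \<tau> (\<tau> i)"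
      then have "inv \<tau> j \<le> i" using inv2 by simp
      moreover have "inv \<tau> j \<noteq> i" using j inv1[of j] by auto
      moreover have "inv \<tau> j \<in> {1..n}" using in_iff[of "inv \<tau> j"] inv1[of j] j k by auto
      ultimately have "\<tau> (inv \<tau> j) > \<tau> i" using i by (auto simp: R_def)
      then show False using j inv1 by simp
    qed
    ultimately have "\<tau> i \<in> Q" by (auto simp: Q_def)
    then show "i \<in> inv \<tau> ` Q" using inv2[of i] by (metis image_eqI)
  qed
  have inj: "inj (inv \<tau>)" by (rule permutes_inj[OF permutes_inv[OF perm]])
  then have cardQ: "card (inv \<tau> ` Q) = card Q"
    by (intro card_image) (auto intro: inj_on_subset)
  have disj: "P \<inter> inv \<tau> ` Q = {}"
    using esc unfolding P Q by (auto simp: R_def dest: leD)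
  have rec: "low_rec k \<tau> = card P" "low_rec k (inv \<tau>) = card (inv \<tau> ` Q)" "low_rec n \<tau> = card R"
    unfolding cardQ by (simp_all add: low_rec_def P_def Q_def R_def)
  have union: "card (P \<union> inv \<tau> ` Q) = card P + card (inv \<tau> ` Q)"
    using fin disj by (intro card_Un_disjoint) auto
  have "card (P \<union> inv \<tau> ` Q) \<le> card R"
    using fin by (intro card_mono) (auto simp: P Q)
  then show "low_rec k \<tau> + low_rec k (inv \<tau>) \<le> low_rec n \<tau>"
    using rec union by simp
  assume i\<^sub>0: "i\<^sub>0 \<in> {1..k}" "\<tau> i\<^sub>0 \<le> A" and j\<^sub>0: "j\<^sub>0 \<in> {1..k}" "inv \<tau> j\<^sub>0 \<le> A"
  have "R \<subseteq> (P \<union> inv \<tau> ` Q) \<union> {i \<in> {1..A}. \<tau> i \<le> A}"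
  proof
    fix i assume i: "i \<in> R"
    show "i \<in> (P \<union> inv \<tau> ` Q) \<union> {i \<in> {1..A}. \<tau> i \<le> A}"
    proof (cases "i \<le> k \<or> \<tau> i \<le> k")
      case True
      then show ?thesis using i by (auto simp: P Q)
    next
      case False
      have "\<tau> i < \<tau> i\<^sub>0" using i i\<^sub>0 False k by (auto simp: R_def)
      moreover have "i \<le> inv \<tau> j\<^sub>0"
      proof (rule ccontr)
        assume "\<not> i \<le> inv \<tau> j\<^sub>0"
        moreover have "inv \<tau> j\<^sub>0 \<in> {1..n}" using in_iff[of "inv \<tau> j\<^sub>0"] inv1[of j\<^sub>0] j\<^sub>0 k by auto
        ultimately have "\<tau> (inv \<tau> j\<^sub>0) > \<tau> i" using i by (auto simp: R_def)
        then show False using False j\<^sub>0 inv1 by simp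
      qed
      ultimately show ?thesis using i i\<^sub>0 j\<^sub>0 by (auto simp: R_def)
    qed
  qed
  then have "card R \<le> card ((P \<union> inv \<tau> ` Q) \<union> {i \<in> {1..A}. \<tau> i \<le> A})"
    using fin by (intro card_mono) auto
  also have "\<dots> \<le> card (P \<union> inv \<tau> ` Q) + card {i \<in> {1..A}. \<tau> i \<le> A}"
    by (rule card_Un_le)
  finally show "low_rec n \<tau> \<le> low_rec k \<tau> + low_rec k (inv \<tau>) + card {i \<in> {1..A}. \<tau> i \<le> A}"
    using rec union by simp
qed

text \<open>The \<open>k\<close> letters of the head word form a uniformly random \<open>k\<close>-subset of \<open>{k<..n}\<close>, so it misses
  all \<open>A - k\<close> letters of \<open>{k<..A}\<close> with probability at most \<open>(1 - k / (n - k)) ^ (A - k)\<close>.\<close>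

lemma card_escaping_high:
  assumes k: "2 * k < n" and A: "k \<le> A" "A \<le> n"
  shows "real (card {\<tau> \<in> escaping k. \<forall>i\<in>{1..k}. A < \<tau> i})
           \<le> exp (- (real k * real (A - k) / real n)) * real (card S)"
proof -
  define a b m where "a = n - 2 * k" and "b = n - k" and "m = A - k"
  have ab: "a \<le> b" "b > 0" "m \<le> b" using k A by (auto simp: a_def b_def m_def)
  have eq: "{\<tau> \<in> escaping k. \<forall>i\<in>{1..k}. A < \<tau> i} = {\<tau> \<in> escaping k. \<tau> ` {1..k} \<inter> {k<..A} = {}}"
    using A by (fastforce simp: escaping_def not_le)
  have subset_high: "{k<..A} \<subseteq> {k<..n}" using A by auto
  have "(b choose m) * b ^ m * card {\<tau> \<in> escaping k. \<tau> ` {1..k} \<inter> {k<..A} = {}} =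
      (a choose m) * b ^ m * card (escaping k)"
    using card_escaping_avoiding[of "{k<..A}" k] k
    by (simp add: a_def b_def m_def subset_high)
  also have "\<dots> \<le> ((b choose m) * a ^ m) * card S"
    using finite_S escaping_subset ab by (intro mult_mono card_mono binomial_ratio_le_power) auto
  finally have "(b choose m) * (b ^ m * card {\<tau> \<in> escaping k. \<forall>i\<in>{1..k}. A < \<tau> i}) \<le>
      (b choose m) * (a ^ m * card S)"
    unfolding eq by (simp only: mult.assoc)
  then have "b ^ m * card {\<tau> \<in> escaping k. \<forall>i\<in>{1..k}. A < \<tau> i} \<le> a ^ m * card S"
    using ab by simp
  then have "real (b ^ m * card {\<tau> \<in> escaping k. \<forall>i\<in>{1..k}. A < \<tau> i}) \<le> real (a ^ m * card S)"
    by (rule of_nat_mono)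
  then have "real (card {\<tau> \<in> escaping k. \<forall>i\<in>{1..k}. A < \<tau> i}) \<le> (real a / real b) ^ m * real (card S)"
    using ab by (simp add: field_simps)
  also have "(real a / real b) ^ m \<le> exp (- (real k / real n)) ^ m"
  proof (rule power_mono)
    have "real a / real b = 1 - real k / real b"
      using k by (simp add: a_def b_def field_simps of_nat_diff)
    also have "\<dots> \<le> 1 - real k / real n"
      using k by (intro diff_left_mono divide_left_mono) (auto simp: b_def)
    also have "\<dots> \<le> exp (- (real k / real n))"
      using exp_ge_add_one_self[of "- (real k / real n)"] by simp
    finally show "real a / real b \<le> exp (- (real k / real n))" .
  qed simp
  also have "exp (- (real k / real n)) ^ m = exp (- (real k * real (A - k) / real n))"
    by (simp add: exp_of_nat_mult[symmetric] m_def mult.commute)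
  finally show ?thesis by (simp add: mult_right_mono)
qed

end

section \<open>Comparison of characteristic functions\<close>

text \<open>The probability generating function of the number of low records of a uniform permutation of \<open>k\<close> letters.\<close>

definition record_pgf :: "nat \<Rightarrow> complex \<Rightarrow> complex" where
  "record_pgf k z = (\<Prod>j=1..k. z + of_nat (j - 1)) / fact k"

lemma norm_iexp_diff_le: "norm (iexp x - iexp y) \<le> \<bar>x - y\<bar>"
proof -
  have "iexp x - iexp y = iexp y * (iexp (x - y) - 1)"
    by (simp add: algebra_simps exp_add[symmetric])
  then have "norm (iexp x - iexp y) = norm (iexp (x - y) - 1)"
    by (simp add: norm_mult)
  also have "\<dots> \<le> \<bar>x - y\<bar>"
    using iexp_approx1[of "x - y" 0] by simp
  finally show ?thesis .
qed

context conjugation_invariant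
begin

text \<open>On an escaping permutation, replacing \<open>low_rec n \<tau>\<close> by the sum of the two head counts costs at most
  \<open>2\<close> if one of the head words has no letter up to \<open>A\<close>, and at most \<open>\<bar>u\<bar>\<close> times the number of
  points in the square \<open>[1, A] \<times> [1, A]\<close> otherwise. A permutation that is not escaping costs at most
  \<open>2\<close>, the norm of its own exponential plus that of the mean \<open>\<psi>\<close> over escaping permutations.\<close>

lemma norm_sum_iexp_low_rec_le:
  fixes \<psi> :: complex
  assumes n: "n \<ge> 2" and k: "2 * k < n" and A: "k \<le> A" "A \<le> n"
    and fixed: "\<And>\<tau>. \<tau> \<in> S \<Longrightarrow> card {i \<in> {1..n}. \<tau> i = i} = a"
    and \<psi>: "norm \<psi> \<le> 1"
      "(\<Sum>\<tau>\<in>escaping k. iexp (u * (real (low_rec k \<tau> + low_rec k (inv \<tau>)) - l))) = real (card (escaping k)) * \<psi>"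
  defines "\<delta> \<equiv> \<lambda>m. real m * real a / real n + (real m)\<^sup>2 / (real n - 1)"
  shows "norm ((\<Sum>\<tau>\<in>S. iexp (u * (real (low_rec n \<tau>) - l))) - real (card S) * \<psi>)
           \<le> (2 * \<delta> k + 4 * exp (- (real k * real (A - k) / real n)) + \<bar>u\<bar> * \<delta> A) * real (card S)"
proof -
  let ?E = "escaping k"
  define f where "f \<tau> = iexp (u * (real (low_rec n \<tau>) - l))" for \<tau>
  define g where "g \<tau> = iexp (u * (real (low_rec k \<tau> + low_rec k (inv \<tau>)) - l))" for \<tau>
  define N where "N \<tau> = card {i \<in> {1..A}. \<tau> i \<le> A}" for \<tau> :: "nat \<Rightarrow> nat"
  define high where "high \<tau> \<longleftrightarrow> (\<forall>i\<in>{1..k}. A < \<tau> i)" for \<tau> :: "nat \<Rightarrow> nat"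
  have norm_fg: "norm (f \<tau>) = 1" "norm (g \<tau>) = 1" for \<tau>
    by (simp_all add: f_def g_def)
  have pointwise: "norm (f \<tau> - g \<tau>) \<le> \<bar>u\<bar> * real (N \<tau>) + 2 * (of_bool (high \<tau>) + of_bool (high (inv \<tau>)))"
    if \<tau>: "\<tau> \<in> ?E" for \<tau>
  proof (cases "high \<tau> \<or> high (inv \<tau>)")
    case True
    have "norm (f \<tau> - g \<tau>) \<le> 2"
      using norm_triangle_ineq4[of "f \<tau>" "g \<tau>"] by (simp add: norm_fg)
    also have "\<dots> \<le> 2 * (of_bool (high \<tau>) + of_bool (high (inv \<tau>)))"
      using True by auto
    finally show ?thesis by (simp add: add_increasing)
  next
    case False
    then obtain i\<^sub>0 j\<^sub>0 where "i\<^sub>0 \<in> {1..k}" "\<tau> i\<^sub>0 \<le> A" "j\<^sub>0 \<in> {1..k}" "inv \<tau> j\<^sub>0 \<le> A"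
      by (auto simp: high_def not_less)
    then have "low_rec k \<tau> + low_rec k (inv \<tau>) \<le> low_rec n \<tau>"
      "low_rec n \<tau> \<le> low_rec k \<tau> + low_rec k (inv \<tau>) + N \<tau>"
      using low_rec_escaping_ge[OF \<tau>] low_rec_escaping_le[OF \<tau>] k by (simp_all add: N_def)
    then have "\<bar>real (low_rec n \<tau>) - real (low_rec k \<tau> + low_rec k (inv \<tau>))\<bar> \<le> real (N \<tau>)"
      by linarith
    then have "\<bar>u\<bar> * \<bar>real (low_rec n \<tau>) - real (low_rec k \<tau> + low_rec k (inv \<tau>))\<bar> \<le> \<bar>u\<bar> * real (N \<tau>)"
      by (rule mult_left_mono) simp
    moreover have "norm (f \<tau> - g \<tau>) \<le> \<bar>u\<bar> * \<bar>real (low_rec n \<tau>) - real (low_rec k \<tau> + low_rec k (inv \<tau>))\<bar>"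
      unfolding f_def g_def abs_mult[symmetric]
      by (rule order_trans[OF norm_iexp_diff_le]) (simp add: algebra_simps)
    ultimately show ?thesis by (simp add: add_increasing2)
  qed
  have card_E: "real (card S) = real (card ?E) + real (card (S - ?E))"
    using finite_S escaping_subset[of k] card_mono[OF finite_S escaping_subset[of k]]
    by (simp add: card_Diff_subset finite_escaping of_nat_diff)
  have "(\<Sum>\<tau>\<in>S. f \<tau>) - real (card S) * \<psi> =
      (\<Sum>\<tau>\<in>?E. f \<tau> - g \<tau>) + (\<Sum>\<tau>\<in>S - ?E. f \<tau>) - real (card (S - ?E)) * \<psi>"
    using sum.subset_diff[OF escaping_subset finite_S, of f k] \<psi>(2)[folded g_def]
    by (simp add: card_E sum_subtractf algebra_simps)
  also have "norm \<dots> \<le> norm (\<Sum>\<tau>\<in>?E. f \<tau> - g \<tau>) + norm (\<Sum>\<tau>\<in>S - ?E. f \<tau>)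
      + norm (real (card (S - ?E)) * \<psi>)"
    by (intro order_trans[OF norm_triangle_ineq4] add_right_mono norm_triangle_ineq)
  also have "norm (\<Sum>\<tau>\<in>S - ?E. f \<tau>) \<le> real (card (S - ?E))"
    by (rule order_trans[OF norm_sum]) (simp add: norm_fg)
  also have "norm (real (card (S - ?E)) * \<psi>) \<le> real (card (S - ?E))"
    using \<psi>(1) by (simp add: norm_mult mult_left_le)
  also have "norm (\<Sum>\<tau>\<in>?E. f \<tau> - g \<tau>) \<le>
      (\<Sum>\<tau>\<in>?E. \<bar>u\<bar> * real (N \<tau>) + 2 * (of_bool (high \<tau>) + of_bool (high (inv \<tau>))))"
    by (rule order_trans[OF norm_sum sum_mono[OF pointwise]])
  also have "\<dots> = \<bar>u\<bar> * (\<Sum>\<tau>\<in>?E. real (N \<tau>)) +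
      2 * ((\<Sum>\<tau>\<in>?E. of_bool (high \<tau>)) + (\<Sum>\<tau>\<in>?E. of_bool (high (inv \<tau>))))"
    by (simp add: sum.distrib sum_distrib_left)
  finally have bound: "norm ((\<Sum>\<tau>\<in>S. f \<tau>) - real (card S) * \<psi>) \<le>
      \<bar>u\<bar> * (\<Sum>\<tau>\<in>?E. real (N \<tau>)) +
      2 * ((\<Sum>\<tau>\<in>?E. of_bool (high \<tau>)) + (\<Sum>\<tau>\<in>?E. of_bool (high (inv \<tau>)))) +
      real (card (S - ?E)) + real (card (S - ?E))"
    by simp
  have high_inv: "(\<Sum>\<tau>\<in>?E. of_bool (high (inv \<tau>)) :: real) = (\<Sum>\<tau>\<in>?E. of_bool (high \<tau>))"
    by (rule sum_escaping_inv)
  have high: "(\<Sum>\<tau>\<in>?E. of_bool (high \<tau>)) \<le> exp (- (real k * real (A - k) / real n)) * real (card S)"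
    using card_escaping_high[OF k A] finite_escaping by (simp add: Int_def high_def)
  have "(\<Sum>\<tau>\<in>?E. real (N \<tau>)) \<le> (\<Sum>\<tau>\<in>S. real (N \<tau>))"
    using finite_S escaping_subset by (intro sum_mono2) auto
  also have "\<dots> \<le> \<delta> A * real (card S)"
    unfolding N_def \<delta>_def by (rule sum_card_square[OF n A(2) fixed])
  finally have residual: "\<bar>u\<bar> * (\<Sum>\<tau>\<in>?E. real (N \<tau>)) \<le> \<bar>u\<bar> * (\<delta> A * real (card S))"
    by (rule mult_left_mono) simp
  have "real (card (S - ?E)) \<le> \<delta> k * real (card S)"
    unfolding \<delta>_def using k
    by (intro order_trans[OF card_not_escaping sum_card_square[OF n _ fixed]]) auto
  moreover have "x \<le> c + 2 * (b + b) + d + d \<Longrightarrow> b \<le> b' \<Longrightarrow> c \<le> c' \<Longrightarrow> d \<le> d' \<Longrightarrow>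
      x \<le> 2 * d' + 4 * b' + c'" for x b c d b' c' d' :: real
    by simp
  ultimately show ?thesis
    using bound high residual unfolding high_inv f_def[symmetric] distrib_right mult.assoc by blast
qed

text \<open>An involution has only one head word, whose record count is therefore doubled.\<close>

lemma sum_iexp_low_rec_involutions:
  assumes k: "k \<le> n" and invol: "\<And>\<tau>. \<tau> \<in> S \<Longrightarrow> \<tau> ^^ 2 = id"
  shows "(\<Sum>\<tau>\<in>escaping k. iexp (u * (real (low_rec k \<tau> + low_rec k (inv \<tau>)) - l)))
    = real (card (escaping k)) * (iexp (- u * l) * record_pgf k (iexp (2 * u)))"
proof -
  have "iexp (u * (real (low_rec k \<tau> + low_rec k (inv \<tau>)) - l)) =
      iexp (- u * l) * iexp (2 * u) ^ low_rec k \<tau>" if "\<tau> \<in> escaping k" for \<tau>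
  proof -
    have "\<tau> \<circ> \<tau> = id"
      using that invol by (simp add: escaping_def numeral_2_eq_2)
    then have "inv \<tau> = \<tau>" by (rule inv_unique_comp) fact
    then show ?thesis
      by (simp add: exp_of_nat_mult[symmetric] exp_add[symmetric] algebra_simps)
  qed
  then have "(\<Sum>\<tau>\<in>escaping k. iexp (u * (real (low_rec k \<tau> + low_rec k (inv \<tau>)) - l))) =
      iexp (- u * l) * (\<Sum>\<tau>\<in>escaping k. iexp (2 * u) ^ low_rec k \<tau> * 1)"
    unfolding sum_distrib_left by (intro sum.cong) simp_all
  moreover have "fact k * (\<Sum>\<tau>\<in>escaping k. iexp (2 * u) ^ low_rec k \<tau> * 1) =
      (\<Prod>j=1..k. iexp (2 * u) + of_nat (j - 1)) * (\<Sum>\<tau>\<in>escaping k. 1)"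
    by (rule sum_power_low_rec_escaping[OF k]) simp
  ultimately show ?thesis
    by (simp add: record_pgf_def field_simps)
qed

text \<open>The two head words use disjoint letters: \<open>inv \<tau> j = \<tau> i\<close> with \<open>i, j \<le> k\<close> would give
  \<open>\<tau> j = \<tau> (\<tau> (\<tau> i)) = i \<le> k\<close>. So the record count of the second word is invariant under
  shuffling the first, and the generating function factorises; inversion of \<open>\<tau>\<close> exchanges the
  two words and makes both factors equal.\<close>

lemma sum_iexp_low_rec_order_three:
  assumes k: "k \<le> n" and order3: "\<And>\<tau>. \<tau> \<in> S \<Longrightarrow> \<tau> ^^ 3 = id"
  shows "(\<Sum>\<tau>\<in>escaping k. iexp (u * (real (low_rec k \<tau> + low_rec k (inv \<tau>)) - l)))
    = real (card (escaping k)) * (iexp (- u * l) * (record_pgf k (iexp u))\<^sup>2)"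
proof -
  let ?p = "\<Prod>j=1..k. iexp u + of_nat (j - 1)"
  let ?G = "\<lambda>\<tau>. iexp u ^ low_rec k (inv \<tau>)"
  have disjoint: "inv \<tau> j \<notin> \<tau> ` {1..k}" if \<tau>: "\<tau> \<in> escaping k" and j: "j \<in> {1..k}" for \<tau> j
  proof
    assume "inv \<tau> j \<in> \<tau> ` {1..k}"
    then obtain i where i: "i \<in> {1..k}" "inv \<tau> j = \<tau> i" by auto
    have "\<tau> permutes {1..n}" "\<tau> (\<tau> (\<tau> j)) = j"
      using \<tau> permutes order3 by (auto simp: escaping_def numeral_3_eq_3 fun_eq_iff)
    then have "\<tau> j = i"
      using i(2) permutes_inverses by metis
    moreover have "k < \<tau> j" using \<tau> j by (simp add: escaping_def)
    ultimately show False using i(1) by simp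
  qed
  have G: "?G (shuffle_images \<sigma> \<tau>) = ?G \<tau>" if \<tau>: "\<tau> \<in> escaping k" and \<sigma>: "\<sigma> permutes {1..k}" for \<tau> \<sigma>
    using low_rec_cong[of k "inv (shuffle_images \<sigma> \<tau>)" "inv \<tau>"]
      inv_shuffle_images_apply[OF k \<sigma> \<tau>] disjoint[OF \<tau>] by simp
  have "fact k * (\<Sum>\<tau>\<in>escaping k. ?G \<tau>) = fact k * (\<Sum>\<tau>\<in>escaping k. iexp u ^ low_rec k \<tau> * 1)"
    using sum_escaping_inv[of "\<lambda>\<tau>. iexp u ^ low_rec k \<tau>" k] by simp
  also have "\<dots> = ?p * (\<Sum>\<tau>\<in>escaping k. 1)"
    by (rule sum_power_low_rec_escaping[OF k]) simp
  finally have one: "fact k * (\<Sum>\<tau>\<in>escaping k. ?G \<tau>) = ?p * of_nat (card (escaping k))"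
    by simp
  have two: "fact k * (\<Sum>\<tau>\<in>escaping k. iexp u ^ low_rec k \<tau> * ?G \<tau>) = ?p * (\<Sum>\<tau>\<in>escaping k. ?G \<tau>)"
    by (rule sum_power_low_rec_escaping[OF k G])
  have "(\<Sum>\<tau>\<in>escaping k. iexp (u * (real (low_rec k \<tau> + low_rec k (inv \<tau>)) - l))) =
      iexp (- u * l) * (\<Sum>\<tau>\<in>escaping k. iexp u ^ low_rec k \<tau> * ?G \<tau>)"
    unfolding sum_distrib_left
    by (intro sum.cong) (simp_all add: exp_of_nat_mult[symmetric] exp_add[symmetric] algebra_simps)
  also have "(\<Sum>\<tau>\<in>escaping k. iexp u ^ low_rec k \<tau> * ?G \<tau>) = of_nat (card (escaping k)) * (?p / fact k)\<^sup>2"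
    using one two by (simp add: field_simps power2_eq_square)
  finally show ?thesis by (simp add: record_pgf_def mult_ac)
qed

end

section \<open>Gaussian limit for the record count of a uniform permutation\<close>

text \<open>The factor of index \<open>j\<close> is the generating function of a Bernoulli variable of parameter \<open>1/j\<close>.\<close>

lemma record_pgf_factors:
  "record_pgf k z = (\<Prod>j=1..k. 1 + (z - 1) / of_nat j)"
proof -
  have "(\<Prod>j=1..k. 1 + (z - 1) / of_nat j) = (\<Prod>j=1..k. (z + of_nat (j - 1)) / of_nat j)"
    by (intro prod.cong refl) (simp add: field_simps of_nat_diff)
  also have "\<dots> = (\<Prod>j=1..k. z + of_nat (j - 1)) / (\<Prod>j=1..k. of_nat j)"
    by (rule prod_dividef)
  also have "(\<Prod>j=1..k. of_nat j) = (fact k :: complex)"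
    by (simp add: fact_prod)
  finally show ?thesis by (simp only: record_pgf_def)
qed

lemma norm_record_factor_le:
  fixes z :: complex
  assumes "norm z \<le> 1" "j \<ge> 1"
  shows "norm (1 + (z - 1) / of_nat j) \<le> 1"
proof -
  have "1 + (z - 1) / of_nat j = of_real (1 - 1 / real j) + z / of_nat j"
    using assms by (simp add: field_simps)
  also have "norm \<dots> \<le> norm (of_real (1 - 1 / real j) :: complex) + norm (z / of_nat j)"
    by (rule norm_triangle_ineq)
  also have "\<dots> \<le> (1 - 1 / real j) + 1 / real j"
    using assms unfolding norm_of_real norm_divide norm_of_nat
    by (intro add_mono divide_right_mono) auto
  finally show ?thesis by simp
qed

lemma sum_inverse_squares_le: "(\<Sum>j=1..k. 1 / (real j)\<^sup>2) \<le> 2"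
proof -
  have "(\<Sum>j=1..k. 1 / (real j)\<^sup>2) \<le> 2 - 1 / real k" if "k \<ge> 1"
    using that
  proof (induction k rule: dec_induct)
    case (step k)
    have "1 / (real (Suc k))\<^sup>2 \<le> 1 / real k - 1 / real (Suc k)"
    proof -
      have "1 / (real (Suc k))\<^sup>2 \<le> 1 / (real k * real (Suc k))"
        using step(1) by (intro divide_left_mono) (auto simp: power2_eq_square)
      also have "\<dots> = 1 / real k - 1 / real (Suc k)"
        using step(1) by (simp add: field_simps)
      finally show ?thesis .
    qed
    then show ?case using step by simp
  qed simp
  then show ?thesis by (cases "k \<ge> 1") (auto intro: order_trans)
qed

text \<open>Poisson approximation: each factor \<open>1 + w\<close> with \<open>w = (z - 1) / j\<close> is within \<open>3 (norm w)\<^sup>2\<close> of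
  \<open>exp w\<close>. All factors and exponentials have norm at most 1, so the errors simply add up.\<close>

lemma norm_record_pgf_minus_exp_le:
  fixes z :: complex
  assumes z: "norm z \<le> 1" "norm (z - 1) \<le> 1"
  shows "norm (record_pgf k z - exp ((z - 1) * harm k)) \<le> 6 * (norm (z - 1))\<^sup>2"
proof -
  have factor: "norm (1 + (z - 1) / of_nat j - exp ((z - 1) / of_nat j)) \<le> 3 * (norm (z - 1))\<^sup>2 * (1 / (real j)\<^sup>2)"
    if j: "j \<in> {1..k}" for j
  proof -
    define w where "w = (z - 1) / of_nat j"
    have w: "norm w \<le> 1"
      using z(2) j unfolding w_def norm_divide by (simp add: divide_le_eq)
    have "norm (1 + w - exp w) = norm (exp w - (\<Sum>i\<le>1. w ^ i / fact i))"
      by (simp add: norm_minus_commute)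
    also have "\<dots> \<le> exp \<bar>Re w\<bar> * norm w ^ 2"
      using Taylor_exp[of w 1] by (simp add: numeral_2_eq_2)
    also have "\<dots> \<le> exp 1 * norm w ^ 2"
      using abs_Re_le_cmod[of w] w by (intro mult_right_mono) auto
    also have "\<dots> \<le> 3 * norm w ^ 2"
      using exp_le by (intro mult_right_mono) auto
    also have "norm w ^ 2 = (norm (z - 1))\<^sup>2 * (1 / (real j)\<^sup>2)"
      by (simp add: w_def norm_divide power_divide)
    finally show ?thesis by (simp add: w_def mult.assoc)
  qed
  have norm_exp: "norm (exp ((z - 1) / of_nat j)) \<le> 1" for j
  proof -
    have "Re z \<le> 1" using complex_Re_le_cmod[of z] z(1) by linarith
    then have "Re ((z - 1) / of_nat j) \<le> 0"
      by (simp add: Re_divide_of_nat divide_nonpos_nonneg)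
    then show ?thesis by simp
  qed
  have "exp ((z - 1) * harm k) = (\<Prod>j=1..k. exp ((z - 1) / of_nat j))"
    by (simp add: exp_sum[symmetric] harm_def sum_distrib_left divide_inverse)
  then have "norm (record_pgf k z - exp ((z - 1) * harm k)) =
      norm ((\<Prod>j=1..k. 1 + (z - 1) / of_nat j) - (\<Prod>j=1..k. exp ((z - 1) / of_nat j)))"
    by (simp only: record_pgf_factors)
  also have "\<dots> \<le> (\<Sum>j=1..k. norm (1 + (z - 1) / of_nat j - exp ((z - 1) / of_nat j)))"
    using norm_record_factor_le[OF z(1)] norm_exp by (intro norm_prod_diff) auto
  also have "\<dots> \<le> (\<Sum>j=1..k. 3 * (norm (z - 1))\<^sup>2 * (1 / (real j)\<^sup>2))"
    by (intro sum_mono factor)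
  also have "\<dots> = 3 * (norm (z - 1))\<^sup>2 * (\<Sum>j=1..k. 1 / (real j)\<^sup>2)"
    by (simp only: sum_distrib_left)
  also have "\<dots> \<le> 3 * (norm (z - 1))\<^sup>2 * 2"
    by (intro mult_left_mono sum_inverse_squares_le) simp
  finally show ?thesis by simp
qed

lemma norm_record_pgf_le:
  fixes z :: complex
  assumes "norm z \<le> 1"
  shows "norm (record_pgf k z) \<le> 1"
  unfolding record_pgf_factors prod_norm[symmetric]
  by (intro prod_le_1 conjI norm_ge_zero norm_record_factor_le[OF assms]) simp

text \<open>By the Poisson approximation it is enough to expand \<open>(iexp \<theta> - 1) H\<close> to second order, where \<open>H\<close> is
  the harmonic number and \<open>\<theta> = s / sqrt l\<close>. The linear term cancels against the centring up to
  \<open>\<theta> (H - l / 2) \<longlonglongrightarrow> 0\<close>, and the quadratic one tends to \<open>- (s\<^sup>2 / 2) / 2\<close> because \<open>H\<close> is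
  about \<open>l / 2\<close>.\<close>

lemma record_pgf_tendsto:
  fixes k :: "nat \<Rightarrow> nat" and l :: "nat \<Rightarrow> real" and s :: real
  assumes l: "filterlim l at_top sequentially"
    and h: "(\<lambda>n. (harm (k n) - l n / 2) / sqrt (l n)) \<longlonglongrightarrow> 0"
  defines "\<theta> \<equiv> \<lambda>n. s / sqrt (l n)"
  shows "(\<lambda>n. iexp (- (\<theta> n * l n / 2)) * record_pgf (k n) (iexp (\<theta> n)))
           \<longlonglongrightarrow> complex_of_real (exp (- (s\<^sup>2 / 4)))"
proof -
  define z where "z n = iexp (\<theta> n)" for n
  define H :: "nat \<Rightarrow> real" where "H n = harm (k n)" for n
  define c where "c n = iexp (- (\<theta> n * l n / 2))" for n
  have l_pos: "\<forall>\<^sub>F n in sequentially. l n > 0"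
    using l by (simp add: filterlim_at_top_dense)
  have inv_sqrt: "(\<lambda>n. a / sqrt (l n)) \<longlonglongrightarrow> 0" for a
    by (rule tendsto_divide_0[OF tendsto_const
          filterlim_at_top_imp_at_infinity[OF filterlim_compose[OF sqrt_at_top l]]])
  then have \<theta>: "\<theta> \<longlonglongrightarrow> 0"
    by (simp add: \<theta>_def)
  have z1: "(\<lambda>n. z n - 1) \<longlonglongrightarrow> 0"
    unfolding z_def by (auto intro!: tendsto_eq_intros \<theta>)
  have norm_c: "norm (c n) = 1" for n by (simp add: c_def)
  have norm_z: "norm (z n) = 1" for n by (simp add: z_def)
  have "(\<lambda>n. \<theta> n * (H n - l n / 2)) \<longlonglongrightarrow> 0"
    using tendsto_mult_right_zero[OF h, of s] by (simp add: \<theta>_def H_def mult.commute)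
  then have "(\<lambda>n. complex_of_real (\<theta> n * (H n - l n / 2))) \<longlonglongrightarrow> of_real 0"
    by (rule tendsto_of_real)
  then have "(\<lambda>n. \<i> * of_real (\<theta> n * (H n - l n / 2))) \<longlonglongrightarrow> \<i> * of_real 0"
    by (rule tendsto_mult_left)
  then have first: "(\<lambda>n. \<i> * of_real (\<theta> n * (H n - l n / 2))) \<longlonglongrightarrow> 0"
    by (simp only: of_real_0 mult_zero_right)
  have "(\<lambda>n. s\<^sup>2 * ((H n - l n / 2) / sqrt (l n) * (1 / sqrt (l n)) + 1 / 2)) \<longlonglongrightarrow> s\<^sup>2 * (0 * 0 + 1 / 2)"
    unfolding H_def by (intro tendsto_intros h inv_sqrt)
  moreover have "\<forall>\<^sub>F n in sequentially.
      s\<^sup>2 * ((H n - l n / 2) / sqrt (l n) * (1 / sqrt (l n)) + 1 / 2) = (\<theta> n)\<^sup>2 * H n"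
    using l_pos
  proof eventually_elim
    case (elim n)
    then have "sqrt (l n) * sqrt (l n) = l n" by simp
    with elim show ?case
      by (simp add: \<theta>_def power_divide field_simps)
  qed
  ultimately have second: "(\<lambda>n. (\<theta> n)\<^sup>2 * H n) \<longlonglongrightarrow> s\<^sup>2 / 2"
    by (auto elim: Lim_transform_eventually)
  define r where "r n = z n - (1 + \<i> * \<theta> n - (\<theta> n)\<^sup>2 / 2)" for n
  have r: "norm (r n * H n) \<le> \<bar>\<theta> n\<bar> * ((\<theta> n)\<^sup>2 * H n)" for n
  proof -
    have "norm (r n) \<le> \<bar>\<theta> n\<bar> ^ 3 / 6"
      using iexp_approx1[of "\<theta> n" 2]
      by (simp add: r_def z_def numeral_2_eq_2 fact_numeral power_mult_distrib power3_eq_cube)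
    also have "\<dots> \<le> \<bar>\<theta> n\<bar> ^ 3" by simp
    finally have "norm (r n) * H n \<le> \<bar>\<theta> n\<bar> ^ 3 * H n"
      by (intro mult_right_mono) (simp_all add: H_def harm_nonneg)
    then show ?thesis
      by (simp add: norm_mult H_def harm_nonneg power3_eq_cube power2_eq_square mult.assoc[symmetric])
  qed
  have "(\<lambda>n. \<bar>\<theta> n\<bar> * ((\<theta> n)\<^sup>2 * H n)) \<longlonglongrightarrow> \<bar>0\<bar> * (s\<^sup>2 / 2)"
    by (intro tendsto_intros \<theta> second)
  then have "(\<lambda>n. \<bar>\<theta> n\<bar> * ((\<theta> n)\<^sup>2 * H n)) \<longlonglongrightarrow> 0"
    by simp
  then have third: "(\<lambda>n. r n * H n) \<longlonglongrightarrow> 0"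
    by (rule Lim_null_comparison[OF always_eventually[OF allI[OF r]]])
  have "(\<lambda>n. \<i> * of_real (\<theta> n * (H n - l n / 2)) - of_real ((\<theta> n)\<^sup>2 * H n) / 2 + r n * H n)
      \<longlonglongrightarrow> 0 - of_real (s\<^sup>2 / 2) / 2 + 0"
    by (intro tendsto_intros first second third) simp
  then have "(\<lambda>n. (z n - 1) * H n - \<i> * of_real (\<theta> n * l n / 2)) \<longlonglongrightarrow> of_real (- (s\<^sup>2 / 4))"
    by (simp add: r_def algebra_simps)
  then have "(\<lambda>n. exp ((z n - 1) * H n - \<i> * of_real (\<theta> n * l n / 2))) \<longlonglongrightarrow> exp (of_real (- (s\<^sup>2 / 4)))"
    by (rule tendsto_exp)
  then have main: "(\<lambda>n. c n * exp ((z n - 1) * H n)) \<longlonglongrightarrow> of_real (exp (- (s\<^sup>2 / 4)))"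
    by (simp add: c_def exp_add[symmetric] exp_of_real[symmetric] algebra_simps)
  let ?P = "\<lambda>n. record_pgf (k n) (z n)"
  have "\<forall>\<^sub>F n in sequentially. norm (c n * ?P n - c n * exp ((z n - 1) * H n)) \<le> 6 * (norm (z n - 1))\<^sup>2"
  proof -
    have "\<forall>\<^sub>F n in sequentially. norm (z n - 1) < 1"
      using tendstoD[OF z1, of 1] by (simp add: dist_norm)
    then show ?thesis
    proof eventually_elim
      case (elim n)
      have "norm (c n * ?P n - c n * exp ((z n - 1) * H n)) = norm (?P n - exp ((z n - 1) * H n))"
        by (simp only: right_diff_distrib[symmetric] norm_mult norm_c mult_1)
      also have "\<dots> \<le> 6 * (norm (z n - 1))\<^sup>2"
        using norm_record_pgf_minus_exp_le[of "z n" "k n"] elim norm_z[of n]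
        by (simp add: H_def of_real_harm)
      finally show ?case .
    qed
  qed
  moreover have "(\<lambda>n. 6 * (norm (z n - 1))\<^sup>2) \<longlonglongrightarrow> 6 * (norm (0 :: complex))\<^sup>2"
    by (intro tendsto_intros z1)
  then have "(\<lambda>n. 6 * (norm (z n - 1))\<^sup>2) \<longlonglongrightarrow> 0"
    by simp
  ultimately have "(\<lambda>n. c n * ?P n - c n * exp ((z n - 1) * H n)) \<longlonglongrightarrow> 0"
    by (rule Lim_null_comparison)
  from tendsto_add[OF this main] show ?thesis
    by (simp add: c_def z_def)
qed

section \<open>Passage to the limit\<close>

lemma funpow_conj:
  assumes "bij \<pi>"
  shows "(\<pi> \<circ> f \<circ> inv \<pi>) ^^ m = \<pi> \<circ> f ^^ m \<circ> inv \<pi>"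
proof (induction m)
  case 0
  then show ?case using assms by (simp add: fun_eq_iff bij_is_surj surj_f_inv_f)
next
  case (Suc m)
  have "inv \<pi> \<circ> \<pi> = id" using assms by (simp add: bij_is_inj)
  then show ?case
    unfolding funpow.simps Suc.IH by (simp add: fun_eq_iff)
qed

lemma conjugation_invariant_prime_order_perms: "conjugation_invariant n (prime_order_perms n p a)"
proof
  fix \<tau> assume \<tau>: "\<tau> \<in> prime_order_perms n p a"
  then have perm: "\<tau> permutes {1..n}" and power: "\<tau> ^^ p = id"
    and fixed: "card {i \<in> {1..n}. \<tau> i = i} = a"
    by (auto simp: prime_order_perms_def)
  show "\<tau> permutes {1..n}" by (rule perm)
  have "(inv \<tau>) ^^ p = inv (\<tau> ^^ p)"
    using permutes_bij[OF perm] by (simp add: inv_fn)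
  moreover have "inv \<tau> i = i \<longleftrightarrow> \<tau> i = i" for i
    using permutes_inv_eq[OF perm] by auto
  ultimately show "inv \<tau> \<in> prime_order_perms n p a"
    using permutes_inv[OF perm] power fixed by (simp add: prime_order_perms_def)
  fix \<pi> :: "nat \<Rightarrow> nat" assume \<pi>: "\<pi> permutes {1..n}"
  have "(\<pi> \<circ> \<tau> \<circ> inv \<pi>) ^^ p = id"
    using funpow_conj[OF permutes_bij[OF \<pi>], where f = \<tau> and m = p] power permutes_inv_o(1)[OF \<pi>] by simp
  moreover have "{i \<in> {1..n}. (\<pi> \<circ> \<tau> \<circ> inv \<pi>) i = i} = \<pi> ` {i \<in> {1..n}. \<tau> i = i}"
  proof (intro equalityI subsetI)
    fix i assume "i \<in> {i \<in> {1..n}. (\<pi> \<circ> \<tau> \<circ> inv \<pi>) i = i}"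
    then have i: "i \<in> {1..n}" "\<pi> (\<tau> (inv \<pi> i)) = i" by auto
    then have "\<tau> (inv \<pi> i) = inv \<pi> i"
      using permutes_inverses(2)[OF \<pi>, of "\<tau> (inv \<pi> i)"] by simp
    moreover have "inv \<pi> i \<in> {1..n}"
      using i(1) permutes_in_image[OF permutes_inv[OF \<pi>]] by blast
    ultimately show "i \<in> \<pi> ` {i \<in> {1..n}. \<tau> i = i}"
      using permutes_inverses(1)[OF \<pi>, of i] by (intro image_eqI[of _ _ "inv \<pi> i"]) auto
  next
    fix i assume "i \<in> \<pi> ` {i \<in> {1..n}. \<tau> i = i}"
    then obtain j where j: "j \<in> {1..n}" "\<tau> j = j" "i = \<pi> j" by auto
    then have "\<pi> j \<in> {1..n}" using permutes_in_image[OF \<pi>] by blast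
    then show "i \<in> {i \<in> {1..n}. (\<pi> \<circ> \<tau> \<circ> inv \<pi>) i = i}"
      using j permutes_inverses(2)[OF \<pi>, of j] by simp
  qed
  moreover have "card (\<pi> ` {i \<in> {1..n}. \<tau> i = i}) = a"
    using fixed card_image[OF inj_on_subset[OF permutes_inj[OF \<pi>] subset_UNIV]] by metis
  ultimately show "\<pi> \<circ> \<tau> \<circ> inv \<pi> \<in> prime_order_perms n p a"
    using perm \<pi> by (simp add: prime_order_perms_def permutes_compose permutes_inv)
qed

text \<open>With \<open>\<omega> = ln n powr (1/16)\<close>, the two scales are \<open>k = sqrt n / \<omega>\<close> and \<open>A = sqrt n * \<omega>\<^sup>2\<close>. Up to
  constants, the error terms are then \<open>1 / \<omega>\<close> for not being escaping, \<open>exp (- \<omega>)\<close> for head words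
  without letters up to \<open>A\<close>, and \<open>\<omega> ^ 4 / sqrt (ln n) = ln n powr (- 1/4)\<close> for the residual
  records. On the logarithmic scale \<open>\<omega>\<close> is negligible: \<open>ln k\<close> differs from
  \<open>ln n / 2\<close> by \<open>O (ln (ln n))\<close> only.\<close>

definition head_length :: "nat \<Rightarrow> nat" where
  "head_length n = nat \<lfloor>sqrt (real n) / ln (real n) powr (1 / 16)\<rfloor>"

definition box_length :: "nat \<Rightarrow> nat" where
  "box_length n = nat \<lfloor>sqrt (real n) * ln (real n) powr (1 / 8)\<rfloor>"

lemma harm_head_length:
  "(\<lambda>n. (harm (head_length n) - ln (real n) / 2) / sqrt (ln (real n))) \<longlonglongrightarrow> 0"
proof -
  have "filterlim (\<lambda>n. real (head_length n)) at_top at_top"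
    unfolding head_length_def by real_asymp
  then have top: "filterlim head_length at_top sequentially"
    by (simp add: filterlim_sequentially_iff_filterlim_real)
  have "(\<lambda>n. harm (head_length n) - ln (real (head_length n))) \<longlonglongrightarrow> (euler_mascheroni :: real)"
    using filterlim_compose[OF euler_mascheroni_LIMSEQ top] .
  moreover have "(\<lambda>n::nat. 1 / sqrt (ln (real n))) \<longlonglongrightarrow> 0"
    by real_asymp
  ultimately have "(\<lambda>n. (harm (head_length n) - ln (real (head_length n))) * (1 / sqrt (ln (real n)))) \<longlonglongrightarrow>
      (euler_mascheroni :: real) * 0"
    by (rule tendsto_mult)
  moreover have "(\<lambda>n. (ln (real (head_length n)) - ln (real n) / 2) / sqrt (ln (real n))) \<longlonglongrightarrow> 0"
    unfolding head_length_def by real_asymp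
  ultimately have "(\<lambda>n. (harm (head_length n) - ln (real (head_length n))) * (1 / sqrt (ln (real n))) +
      (ln (real (head_length n)) - ln (real n) / 2) / sqrt (ln (real n))) \<longlonglongrightarrow> (euler_mascheroni :: real) * 0 + 0"
    by (rule tendsto_add)
  then show ?thesis
    by (simp add: diff_divide_distrib)
qed

text \<open>The bound \<open>\<delta>'\<close> replaces \<open>a n\<close> by \<open>c sqrt n\<close>, which makes all asymptotics explicit.\<close>

lemma error_term_tendsto_0:
  fixes a :: "nat \<Rightarrow> nat" and s :: real
  assumes a: "(\<lambda>n. real (a n)) \<in> O(\<lambda>n. sqrt (real n))"
  defines "\<delta> \<equiv> \<lambda>n m. real m * real (a n) / real n + (real m)\<^sup>2 / (real n - 1)"
  shows "(\<lambda>n. 2 * \<delta> n (head_length n)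
      + 4 * exp (- (real (head_length n) * real (box_length n - head_length n) / real n))
      + \<bar>s / sqrt (ln (real n))\<bar> * \<delta> n (box_length n)) \<longlonglongrightarrow> 0"
proof -
  obtain c where c: "\<forall>\<^sub>F n in sequentially. norm (real (a n)) \<le> c * norm (sqrt (real n))"
    using landau_o.bigE[OF a] by blast
  define \<delta>' where "\<delta>' n m = c * (real m * sqrt (real n) / real n) + (real m)\<^sup>2 / (real n - 1)" for n m
  have \<delta>: "\<forall>\<^sub>F n in sequentially. \<forall>m. 0 \<le> \<delta> n m \<and> \<delta> n m \<le> \<delta>' n m"
    using c eventually_ge_at_top[of 2]
  proof eventually_elim
    case (elim n)
    have "real m * real (a n) / real n \<le> real m * (c * sqrt (real n)) / real n" for m
      using elim by (intro divide_right_mono mult_left_mono) auto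
    then show ?case using elim by (auto simp: \<delta>_def \<delta>'_def mult_ac)
  qed
  have 1: "(\<lambda>n. \<delta>' n (head_length n)) \<longlonglongrightarrow> c * 0 + 0"
    unfolding \<delta>'_def head_length_def by (intro tendsto_intros; real_asymp)
  have 3: "(\<lambda>n. c * (1 / sqrt (ln (real n)) * (real (box_length n) * sqrt (real n) / real n))
      + 1 / sqrt (ln (real n)) * ((real (box_length n))\<^sup>2 / (real n - 1))) \<longlonglongrightarrow> c * 0 + 0"
    unfolding box_length_def by (intro tendsto_intros; real_asymp)
  have "(\<lambda>n. exp (- (real (head_length n) * (real (box_length n) - real (head_length n)) / real n))) \<longlonglongrightarrow> 0"
    unfolding box_length_def head_length_def by real_asymp
  moreover have "\<forall>\<^sub>F n in sequentially. real (head_length n) \<le> real (box_length n)"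
    unfolding box_length_def head_length_def by real_asymp
  ultimately have 2: "(\<lambda>n. exp (- (real (head_length n) * real (box_length n - head_length n) / real n))) \<longlonglongrightarrow> 0"
    by (elim Lim_transform_eventually eventually_mono) (simp add: of_nat_diff)
  have upper: "(\<lambda>n. 2 * \<delta>' n (head_length n)
      + 4 * exp (- (real (head_length n) * real (box_length n - head_length n) / real n))
      + \<bar>s\<bar> * (c * (1 / sqrt (ln (real n)) * (real (box_length n) * sqrt (real n) / real n))
      + 1 / sqrt (ln (real n)) * ((real (box_length n))\<^sup>2 / (real n - 1)))) \<longlonglongrightarrow>
      2 * (c * 0 + 0) + 4 * 0 + \<bar>s\<bar> * (c * 0 + 0)"
    by (intro tendsto_intros 1 2 3)
  show ?thesis
  proof (rule tendsto_sandwich[OF _ _ tendsto_const])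
    show "\<forall>\<^sub>F n in sequentially. 0 \<le> 2 * \<delta> n (head_length n)
      + 4 * exp (- (real (head_length n) * real (box_length n - head_length n) / real n))
      + \<bar>s / sqrt (ln (real n))\<bar> * \<delta> n (box_length n)"
      using \<delta> by eventually_elim simp
    show "\<forall>\<^sub>F n in sequentially. 2 * \<delta> n (head_length n)
      + 4 * exp (- (real (head_length n) * real (box_length n - head_length n) / real n))
      + \<bar>s / sqrt (ln (real n))\<bar> * \<delta> n (box_length n)
      \<le> 2 * \<delta>' n (head_length n)
      + 4 * exp (- (real (head_length n) * real (box_length n - head_length n) / real n))
      + \<bar>s\<bar> * (c * (1 / sqrt (ln (real n)) * (real (box_length n) * sqrt (real n) / real n))
      + 1 / sqrt (ln (real n)) * ((real (box_length n))\<^sup>2 / (real n - 1)))"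
      using \<delta> eventually_ge_at_top[of 2]
    proof eventually_elim
      case (elim n)
      have "\<bar>s / sqrt (ln (real n))\<bar> * \<delta> n (box_length n) \<le> \<bar>s / sqrt (ln (real n))\<bar> * \<delta>' n (box_length n)"
        using elim by (intro mult_left_mono) auto
      also have "\<dots> = \<bar>s\<bar> * (c * (1 / sqrt (ln (real n)) * (real (box_length n) * sqrt (real n) / real n))
          + 1 / sqrt (ln (real n)) * ((real (box_length n))\<^sup>2 / (real n - 1)))"
        using elim by (simp add: \<delta>'_def abs_divide algebra_simps)
      finally show ?case
        using elim by (intro add_mono mult_left_mono) auto
    qed
  qed (use upper in simp)
qed

lemma mean_iexp_low_rec_tendsto:
  fixes a :: "nat \<Rightarrow> nat" and s :: real and \<psi> :: "nat \<Rightarrow> complex"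
  assumes inv: "\<And>n. n \<ge> 1 \<Longrightarrow> conjugation_invariant n (S n)"
    and nonempty: "\<And>n. n \<ge> 1 \<Longrightarrow> S n \<noteq> {}"
    and fixed: "\<And>n \<tau>. n \<ge> 1 \<Longrightarrow> \<tau> \<in> S n \<Longrightarrow> card {i \<in> {1..n}. \<tau> i = i} = a n"
    and a: "(\<lambda>n. real (a n)) \<in> O(\<lambda>n. sqrt (real n))"
    and norm_\<psi>: "\<And>n. norm (\<psi> n) \<le> 1"
    and \<psi>: "\<And>n k. n \<ge> 1 \<Longrightarrow> k = head_length n \<Longrightarrow> k \<le> n \<Longrightarrow>
      (\<Sum>\<tau>\<in>conjugation_invariant.escaping (S n) k.
         iexp (s / sqrt (ln (real n)) * (real (low_rec k \<tau> + low_rec k (inv \<tau>)) - ln (real n))))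
      = real (card (conjugation_invariant.escaping (S n) k)) * \<psi> n"
    and lim: "\<psi> \<longlonglongrightarrow> c"
  shows "(\<lambda>n. (\<Sum>\<tau>\<in>S n. iexp (s * normalized_low_rec n \<tau>)) / real (card (S n))) \<longlonglongrightarrow> c"
proof -
  let ?e = "\<lambda>n. 2 * (real (head_length n) * real (a n) / real n + (real (head_length n))\<^sup>2 / (real n - 1))
      + 4 * exp (- (real (head_length n) * real (box_length n - head_length n) / real n))
      + \<bar>s / sqrt (ln (real n))\<bar> *
        (real (box_length n) * real (a n) / real n + (real (box_length n))\<^sup>2 / (real n - 1))"
  let ?m = "\<lambda>n. (\<Sum>\<tau>\<in>S n. iexp (s * normalized_low_rec n \<tau>)) / real (card (S n))"
  have "\<forall>\<^sub>F n in sequentially. 2 * real (head_length n) < real n"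
    "\<forall>\<^sub>F n in sequentially. real (head_length n) \<le> real (box_length n)"
    "\<forall>\<^sub>F n in sequentially. real (box_length n) \<le> real n"
    unfolding box_length_def head_length_def by real_asymp+
  then have "\<forall>\<^sub>F n in sequentially. norm (?m n - \<psi> n) \<le> ?e n"
    using eventually_ge_at_top[of 2]
  proof eventually_elim
    case (elim n)
    interpret conjugation_invariant n "S n" using inv elim by simp
    have card: "real (card (S n)) > 0"
      using nonempty[of n] finite_S elim by (simp add: card_gt_0_iff)
    have "norm ((\<Sum>\<tau>\<in>S n. iexp (s / sqrt (ln (real n)) * (real (low_rec n \<tau>) - ln (real n)))) -
        real (card (S n)) * \<psi> n) \<le> ?e n * real (card (S n))"
      using elim fixed norm_\<psi> \<psi>[OF _ refl]
      by (intro norm_sum_iexp_low_rec_le) auto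
    also have "(\<Sum>\<tau>\<in>S n. iexp (s / sqrt (ln (real n)) * (real (low_rec n \<tau>) - ln (real n)))) =
        (\<Sum>\<tau>\<in>S n. iexp (s * normalized_low_rec n \<tau>))"
      by (simp add: normalized_low_rec_def)
    also have "\<dots> - real (card (S n)) * \<psi> n = real (card (S n)) * (?m n - \<psi> n)"
      using card by (simp add: field_simps)
    finally have "real (card (S n)) * norm (?m n - \<psi> n) \<le> real (card (S n)) * ?e n"
      by (simp add: norm_mult mult.commute)
    then show ?case
      using card by (rule mult_le_cancel_left_pos[THEN iffD1, rotated])
  qed
  then have "(\<lambda>n. ?m n - \<psi> n) \<longlonglongrightarrow> 0"
    by (rule Lim_null_comparison[OF _ error_term_tendsto_0[OF a]])
  from tendsto_add[OF this lim] show ?thesis by simp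
qed

lemma char_uniform_cyclic_perm:
  assumes "finite (cyclic_perms n t)" "cyclic_perms n t \<noteq> {}"
  shows "char (distr (measure_pmf (uniform_cyclic_perm n t)) borel X) s =
    (\<Sum>\<tau>\<in>cyclic_perms n t. iexp (s * X \<tau>)) / real (card (cyclic_perms n t))"
proof -
  let ?S = "cyclic_perms n t"
  have "char (distr (measure_pmf (uniform_cyclic_perm n t)) borel X) s =
      measure_pmf.expectation (pmf_of_set ?S) (\<lambda>\<tau>. iexp (s * X \<tau>))"
    unfolding char_def uniform_cyclic_perm_def by (subst integral_distr) auto
  also have "\<dots> = (\<Sum>\<tau>\<in>?S. pmf (pmf_of_set ?S) \<tau> *\<^sub>R iexp (s * X \<tau>))"
    using assms by (intro integral_measure_pmf) auto
  also have "\<dots> = (\<Sum>\<tau>\<in>?S. iexp (s * X \<tau>) / real (card ?S))"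
    using assms by (intro sum.cong) (auto simp: scaleR_conv_of_real field_simps)
  finally show ?thesis
    by (simp only: sum_divide_distrib)
qed

lemma centered_normal_eq_distr:
  assumes "v > 0"
  shows "centered_normal v = distr std_normal_distribution borel (\<lambda>x. sqrt v * x)"
proof -
  interpret prob_space std_normal_distribution
    by (rule prob_space_normal_density) simp
  have "distributed std_normal_distribution lborel (\<lambda>x. x) (normal_density 0 1)"
    by (auto simp: distributed_def distr_id2)
  from normal_density_affine[OF this, of "sqrt v" 0] assms
  have "distributed std_normal_distribution lborel (\<lambda>x. sqrt v * x) (normal_density 0 (sqrt v))"
    by simp
  then have "distr std_normal_distribution lborel (\<lambda>x. sqrt v * x) = centered_normal v"
    by (simp add: distributed_def centered_normal_def)
  then show ?thesis
    by (metis distr_cong sets_lborel)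
qed

lemma real_distribution_centered_normal:
  assumes "v > 0"
  shows "real_distribution (centered_normal v)"
proof -
  interpret prob_space std_normal_distribution
    by (rule prob_space_normal_density) simp
  show ?thesis
    unfolding centered_normal_eq_distr[OF assms] by (rule real_distribution_distr) simp
qed

lemma char_centered_normal:
  assumes "v > 0"
  shows "char (centered_normal v) s = complex_of_real (exp (- (v * s\<^sup>2 / 2)))"
proof -
  have "char (centered_normal v) s = char std_normal_distribution (s * sqrt v)"
    unfolding centered_normal_eq_distr[OF assms] char_def
    by (subst integral_distr) (auto simp: mult_ac)
  also have "\<dots> = complex_of_real (exp (- (v * s\<^sup>2 / 2)))"
    using assms by (simp add: char_std_normal_distribution power_mult_distrib mult.commute)
  finally show ?thesis .
qed

text \<open>The reduction common to both parts: it remains to provide the mean \<open>\<psi> s\<close> of the head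
  exponentials over escaping permutations, and its limit.\<close>

lemma weak_conv_low_rec:
  fixes \<psi> :: "real \<Rightarrow> nat \<Rightarrow> complex"
  assumes ct: "\<And>n. n \<ge> 1 \<Longrightarrow> cycle_type n (t n)"
    and a: "(\<lambda>n. real (t n 1)) \<in> O(\<lambda>n. sqrt (real n))"
    and p: "prime p" and tp: "\<forall>n\<ge>1. t n 1 + p * t n p = n" and v: "v > 0"
    and norm_\<psi>: "\<And>s n. norm (\<psi> s n) \<le> 1"
    and \<psi>: "\<And>s n k. n \<ge> 1 \<Longrightarrow> k = head_length n \<Longrightarrow> k \<le> n \<Longrightarrow>
      (\<Sum>\<tau>\<in>conjugation_invariant.escaping (prime_order_perms n p (t n 1)) k.
         iexp (s / sqrt (ln (real n)) * (real (low_rec k \<tau> + low_rec k (inv \<tau>)) - ln (real n))))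
      = real (card (conjugation_invariant.escaping (prime_order_perms n p (t n 1)) k)) * \<psi> s n"
    and lim: "\<And>s. \<psi> s \<longlonglongrightarrow> complex_of_real (exp (- (v * s\<^sup>2 / 2)))"
  shows "weak_conv_m
    (\<lambda>n. distr (measure_pmf (uniform_cyclic_perm n (t n))) borel (normalized_low_rec n)) (centered_normal v)"
proof (rule levy_continuity)
  show "real_distribution (distr (measure_pmf (uniform_cyclic_perm n (t n))) borel (normalized_low_rec n))" for n
    by (rule prob_space.real_distribution_distr[OF prob_space_measure_pmf]) simp
  show "real_distribution (centered_normal v)"
    by (rule real_distribution_centered_normal[OF v])
  fix s
  let ?S = "\<lambda>n. prime_order_perms n p (t n 1)"
  have S: "cyclic_perms n (t n) = ?S n" if "n \<ge> 1" for n
    using cyclic_perms_eq_prime_order_perms[OF ct[OF that] p] tp that by simp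
  have nonempty: "?S n \<noteq> {}" if "n \<ge> 1" for n
    using prime_order_perms_nonempty[OF prime_gt_1_nat[OF p]] tp that by metis
  have "(\<lambda>n. (\<Sum>\<tau>\<in>?S n. iexp (s * normalized_low_rec n \<tau>)) / real (card (?S n)))
      \<longlonglongrightarrow> complex_of_real (exp (- (v * s\<^sup>2 / 2)))"
    using conjugation_invariant_prime_order_perms nonempty _ a norm_\<psi> \<psi> lim
    by (rule mean_iexp_low_rec_tendsto) (auto simp: prime_order_perms_def)
  moreover have "\<forall>\<^sub>F n in sequentially.
      (\<Sum>\<tau>\<in>?S n. iexp (s * normalized_low_rec n \<tau>)) / real (card (?S n)) =
      char (distr (measure_pmf (uniform_cyclic_perm n (t n))) borel (normalized_low_rec n)) s"
    using eventually_ge_at_top[of 1]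
  proof eventually_elim
    case (elim n)
    have "finite (?S n)"
      by (rule conjugation_invariant.finite_S[OF conjugation_invariant_prime_order_perms])
    then show ?case
      using char_uniform_cyclic_perm[of n "t n" "normalized_low_rec n" s] nonempty[OF elim]
      unfolding S[OF elim] by simp
  qed
  ultimately show "(\<lambda>n. char (distr (measure_pmf (uniform_cyclic_perm n (t n))) borel (normalized_low_rec n)) s)
      \<longlonglongrightarrow> char (centered_normal v) s"
    unfolding char_centered_normal[OF v] by (rule Lim_transform_eventually)
qed

lemma record_pgf_ln_tendsto:
  defines "u \<equiv> \<lambda>s n. s / sqrt (ln (real n))"
  shows "(\<lambda>n. iexp (- (u s n * ln (real n) / 2)) *
      record_pgf (head_length n) (iexp (u s n)))
    \<longlonglongrightarrow> complex_of_real (exp (- (s\<^sup>2 / 4)))"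
  unfolding u_def
  by (rule record_pgf_tendsto[OF _ harm_head_length]) real_asymp

theorem proposition2p12:
  fixes t :: "nat \<Rightarrow> nat \<Rightarrow> nat"
  assumes "\<And>n. n \<ge> 1 \<Longrightarrow> cycle_type n (t n)"
    and "(\<lambda>n. real (t n 1)) \<in> O(\<lambda>n. sqrt (real n))"
  shows "((\<forall>n\<ge>1. t n 1 + 2 * t n 2 = n) \<longrightarrow>
           weak_conv_m
             (\<lambda>n. distr (measure_pmf (uniform_cyclic_perm n (t n))) borel (normalized_low_rec n))
             (centered_normal 2)) \<and>
         ((\<forall>n\<ge>1. t n 1 + 3 * t n 3 = n) \<longrightarrow>
           weak_conv_m
             (\<lambda>n. distr (measure_pmf (uniform_cyclic_perm n (t n))) borel (normalized_low_rec n))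
             (centered_normal 1))"
proof (intro conjI impI)
  let ?u = "\<lambda>s n. s / sqrt (ln (real n))"
  let ?c = "\<lambda>s n. iexp (- ?u s n * ln (real n))"
  let ?P = "\<lambda>s n. record_pgf (head_length n) (iexp (?u s n))"
  have norm_P: "norm (?P s n) \<le> 1" for s n
    by (rule norm_record_pgf_le) simp
  {
    assume tp: "\<forall>n\<ge>1. t n 1 + 2 * t n 2 = n"
    show "weak_conv_m
        (\<lambda>n. distr (measure_pmf (uniform_cyclic_perm n (t n))) borel (normalized_low_rec n)) (centered_normal 2)"
    proof (rule weak_conv_low_rec[OF assms two_is_prime_nat tp, where \<psi> = "\<lambda>s n. ?c s n * ?P (2 * s) n"])
      show "norm (?c s n * ?P (2 * s) n) \<le> 1" for s n
        using norm_P[where s = "2 * s" and n = n] by (simp only: norm_mult norm_exp_i_times mult_1)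
      show "(\<lambda>n. ?c s n * ?P (2 * s) n) \<longlonglongrightarrow> complex_of_real (exp (- (2 * s\<^sup>2 / 2)))" for s
        using record_pgf_ln_tendsto[of "2 * s"] by (simp add: power_mult_distrib)
      fix s n k assume "n \<ge> 1" and k: "k = head_length n" "k \<le> n"
      interpret conjugation_invariant n "prime_order_perms n 2 (t n 1)"
        by (rule conjugation_invariant_prime_order_perms)
      show "(\<Sum>\<tau>\<in>escaping k. iexp (?u s n * (real (low_rec k \<tau> + low_rec k (inv \<tau>)) - ln (real n)))) =
          real (card (escaping k)) * (?c s n * ?P (2 * s) n)"
        using sum_iexp_low_rec_involutions[OF k(2), of "?u s n" "ln (real n)"] k(1)
        by (simp add: prime_order_perms_def)
    qed simp_all
  next
    assume tp: "\<forall>n\<ge>1. t n 1 + 3 * t n 3 = n"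
    have prime_3: "prime (3 :: nat)" by simp
    show "weak_conv_m
        (\<lambda>n. distr (measure_pmf (uniform_cyclic_perm n (t n))) borel (normalized_low_rec n)) (centered_normal 1)"
    proof (rule weak_conv_low_rec[OF assms prime_3 tp, where \<psi> = "\<lambda>s n. ?c s n * (?P s n)\<^sup>2"])
      show "norm (?c s n * (?P s n)\<^sup>2) \<le> 1" for s n
        using power_le_one[OF norm_ge_zero norm_P[where s = s and n = n], of 2] by (simp only: norm_mult norm_power norm_exp_i_times mult_1)
      show "(\<lambda>n. ?c s n * (?P s n)\<^sup>2) \<longlonglongrightarrow> complex_of_real (exp (- (1 * s\<^sup>2 / 2)))" for s
      proof -
        have "(iexp (- (?u s n * ln (real n) / 2)))\<^sup>2 = ?c s n" for n
          by (simp add: exp_double[symmetric])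
        moreover have "(complex_of_real (exp (- (s\<^sup>2 / 4))))\<^sup>2 = complex_of_real (exp (- (1 * s\<^sup>2 / 2)))"
          by (simp add: of_real_power[symmetric] exp_double[symmetric] del: of_real_power)
        ultimately show ?thesis
          using tendsto_power[OF record_pgf_ln_tendsto[of s], of 2] by (simp only: power_mult_distrib)
      qed
      fix s n k assume "n \<ge> 1" and k: "k = head_length n" "k \<le> n"
      interpret conjugation_invariant n "prime_order_perms n 3 (t n 1)"
        by (rule conjugation_invariant_prime_order_perms)
      show "(\<Sum>\<tau>\<in>escaping k. iexp (?u s n * (real (low_rec k \<tau> + low_rec k (inv \<tau>)) - ln (real n)))) =
          real (card (escaping k)) * (?c s n * (?P s n)\<^sup>2)"
        using sum_iexp_low_rec_order_three[OF k(2), of "?u s n" "ln (real n)"] k(1)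
        by (simp add: prime_order_perms_def)
    qed simp_all
  }
qed

end
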